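(* Let $\mathbb X\subset\mathbb R^n$ be a compact convex set with nonempty interior such that $(x-x^0)^\top f(x,\xi)>0$ for every realization $\xi\in\Omega$, every $x\notin\mathrm{int}(\mathbb X)$ and every $x^0\in\mathrm{int}(\mathbb X)$. Let $x^0\in\mathrm{int}(\mathbb X)$ be given, let $h:\mathbb R^n\times[0,1]\to\mathbb R^n$ be the homotopy mapping $h(x,t)=(1-t)d(x,t)+t(x-x^0)$, and let $H^{-1}=\{(x,t)\in\mathbb R^n\times[0,1] : h(x,t)=0\}$. Suppose that zero is a regular value of $h$ on $\mathbb R^n\times(0,1)$. Then there exists an everywhere smooth path in $H^{-1}$ which starts from $(x^0,1)$, the unique solution on the level $t=1$, and ends on the level $t=0$ at a solution $x$ of the sample-average equation $\frac1N\sum_{i=1}^N f(x,\xi_i)=0$.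
   Context: Setting. $\xi$ is a random parameter with realizations in $\Omega$; for each $\xi\in\Omega$, $f(\cdot,\xi):\mathbb R^n\to\mathbb R^n$ is continuously differentiable. Fix samples $\xi_1,\dots,\xi_N\in\Omega$ with $N\ge1$. Construction of $d$. Let $L$ be an integer with $1\le L\le N$, let $0<q_1<q_2<\dots<q_L=N$ be integers, and let $1=t_0>t_1>\dots>t_L=0$. For $\ell=1,\dots,L$ put $f^\ell(x)=\frac1{q_\ell}\sum_{i=1}^{q_\ell}f(x,\xi_i)$, and put $f^0(x)=0\in\mathbb R^n$ for all $x$. For $\ell=1,\dots,L$ and $t\in[t_\ell,t_{\ell-1}]$ let $$\theta_\ell(t)=\sin^2\!\left(\frac{t-t_{\ell-1}}{t_\ell-t_{\ell-1}}\cdot\frac{\pi}{2}\right),\qquad d^\ell(x,t)=(1-\theta_\ell(t))f^{\ell-1}(x)+\theta_\ell(t)f^\ell(x).$$ Define $d:\mathbb R^n\times[0,1]\to\mathbb R^n$ by $d(x,t)=d^\ell(x,t)$ for $t\in[t_\ell,t_{\ell-1}]$ (the definitions agree at the common endpoints). Zero is a regular value of $h$ on a set if the Jacobian matrix of $h$ with respect to $(x,t)$ has full row rank $n$ at every zero of $h$ in that set. "Smooth" refers to continuous differentiability ($h$ is $C^1$).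
   Formalization: Regularity only on (0,1) does not force convergence at t=0: the path is smooth before its end, t tends to 0, and the solution is a limit point; the path is continuous at its end if that solution is isolated, and smooth there if zero is also a regular value at t=0. *)

theory Defs
  imports "HOL-Analysis.Analysis"
begin

definition continuously_differentiable ::
    "('a::real_normed_vector \<Rightarrow> 'b::real_normed_vector) \<Rightarrow> bool" where
  "continuously_differentiable g \<longleftrightarrow>
     (\<exists>g' :: 'a \<Rightarrow> ('a \<Rightarrow>\<^sub>L 'b).
        (\<forall>x. (g has_derivative blinfun_apply (g' x)) (at x)) \<and> continuous_on UNIV g')"

definition sample_avg ::
    "(real^'n \<Rightarrow> 'w \<Rightarrow> real^'n) \<Rightarrow> (nat \<Rightarrow> 'w) \<Rightarrow> nat \<Rightarrow> real^'n \<Rightarrow> real^'n" where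
  "sample_avg f \<xi> m x = (1 / real m) *\<^sub>R (\<Sum>i=1..m. f x (\<xi> i))"

definition level_map ::
    "(real^'n \<Rightarrow> 'w \<Rightarrow> real^'n) \<Rightarrow> (nat \<Rightarrow> 'w) \<Rightarrow> (nat \<Rightarrow> nat) \<Rightarrow> nat \<Rightarrow> real^'n \<Rightarrow> real^'n" where
  "level_map f \<xi> q l x = (if l = 0 then 0 else sample_avg f \<xi> (q l) x)"

definition theta :: "(nat \<Rightarrow> real) \<Rightarrow> nat \<Rightarrow> real \<Rightarrow> real" where
  "theta \<tau> l t = (sin ((t - \<tau> (l - 1)) / (\<tau> l - \<tau> (l - 1)) * (pi / 2)))\<^sup>2"

definition d_piece ::
    "(real^'n \<Rightarrow> 'w \<Rightarrow> real^'n) \<Rightarrow> (nat \<Rightarrow> 'w) \<Rightarrow> (nat \<Rightarrow> nat) \<Rightarrow> (nat \<Rightarrow> real)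
      \<Rightarrow> nat \<Rightarrow> real^'n \<Rightarrow> real \<Rightarrow> real^'n" where
  "d_piece f \<xi> q \<tau> l x t =
     (1 - theta \<tau> l t) *\<^sub>R level_map f \<xi> q (l - 1) x + theta \<tau> l t *\<^sub>R level_map f \<xi> q l x"

text \<open>At a common endpoint of two intervals either index may be used (lemma \<open>d_map_eq\<close> below).
  Values for \<open>t\<close> outside \<open>{0..1}\<close> carry no meaning.\<close>

definition d_map ::
    "(real^'n \<Rightarrow> 'w \<Rightarrow> real^'n) \<Rightarrow> (nat \<Rightarrow> 'w) \<Rightarrow> (nat \<Rightarrow> nat) \<Rightarrow> (nat \<Rightarrow> real) \<Rightarrow> nat
      \<Rightarrow> real^'n \<Rightarrow> real \<Rightarrow> real^'n" where
  "d_map f \<xi> q \<tau> L x t =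
     d_piece f \<xi> q \<tau> (LEAST l. l \<in> {1..L} \<and> t \<in> {\<tau> l..\<tau> (l - 1)}) x t"

definition homotopy_map ::
    "(real^'n \<Rightarrow> 'w \<Rightarrow> real^'n) \<Rightarrow> (nat \<Rightarrow> 'w) \<Rightarrow> (nat \<Rightarrow> nat) \<Rightarrow> (nat \<Rightarrow> real) \<Rightarrow> nat
      \<Rightarrow> real^'n \<Rightarrow> (real^'n) \<times> real \<Rightarrow> real^'n" where
  "homotopy_map f \<xi> q \<tau> L x0 = (\<lambda>(x, t). (1 - t) *\<^sub>R d_map f \<xi> q \<tau> L x t + t *\<^sub>R (x - x0))"

definition H_inv :: "((real^'n) \<times> real \<Rightarrow> real^'n) \<Rightarrow> ((real^'n) \<times> real) set" where
  "H_inv h = {p \<in> UNIV \<times> {0..1}. h p = 0}"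

text \<open>The \<open>n \<times> (n + 1)\<close> Jacobian matrix: column \<open>Some j\<close> belongs to the variable \<open>x $ j\<close>,
  column \<open>None\<close> to \<open>t\<close>. The derivative is taken within the domain of the homotopy, so it is
  one-sided in \<open>t\<close> at \<open>t = 0\<close> and \<open>t = 1\<close>.\<close>

definition jacobian_xt :: "((real^'n) \<times> real \<Rightarrow> real^'n) \<Rightarrow> (real^'n) \<times> real \<Rightarrow> real^('n option)^'n" where
  "jacobian_xt h p =
     (\<chi> i j. frechet_derivative h (at p within UNIV \<times> {0..1})
               (case j of Some k \<Rightarrow> (axis k 1, 0) | None \<Rightarrow> (0, 1)) $ i)"

definition zero_regular_value_on ::
    "((real^'n) \<times> real \<Rightarrow> real^'n) \<Rightarrow> ((real^'n) \<times> real) set \<Rightarrow> bool" where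
  "zero_regular_value_on h S \<longleftrightarrow> (\<forall>p\<in>S. h p = 0 \<longrightarrow> rank (jacobian_xt h p) = CARD('n))"

text \<open>Nonvanishing velocity rules out parametrizations that stop in order to turn a corner;
  without it a continuously differentiable parametrization could have a non-smooth image.\<close>

definition smooth_curve_on :: "real set \<Rightarrow> (real \<Rightarrow> 'a::real_normed_vector) \<Rightarrow> bool" where
  "smooth_curve_on S \<gamma> \<longleftrightarrow>
     (\<exists>\<gamma>'. (\<forall>s\<in>S. (\<gamma> has_vector_derivative \<gamma>' s) (at s within S)) \<and>
           continuous_on S \<gamma>' \<and> (\<forall>s\<in>S. \<gamma>' s \<noteq> 0))"

lemma d_map_eq:
  assumes dec: "\<And>l. l < L \<Longrightarrow> \<tau> (Suc l) < \<tau> l"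
    and l: "l \<in> {1..L}" and t: "t \<in> {\<tau> l..\<tau> (l - 1)}"
  shows "d_map f \<xi> q \<tau> L x t = d_piece f \<xi> q \<tau> l x t"
proof -
  define m where "m = (LEAST l. l \<in> {1..L} \<and> t \<in> {\<tau> l..\<tau> (l - 1)})"
  have m: "m \<in> {1..L}" "t \<in> {\<tau> m..\<tau> (m - 1)}"
    using LeastI[of "\<lambda>l. l \<in> {1..L} \<and> t \<in> {\<tau> l..\<tau> (l - 1)}" l] l t unfolding m_def by auto
  have "m \<le> l" unfolding m_def by (rule Least_le) (use l t in auto)
  have anti: "\<tau> b < \<tau> a" if "a < b" "b \<le> L" for a b
    using that
  proof (induction b)
    case (Suc b)
    then show ?case using dec[of b] by (cases "a = b") auto
  qed simp
  show ?thesis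
  proof (cases "m = l")
    case True
    then show ?thesis by (simp add: d_map_def m_def)
  next
    case False
    then have "m < l" using \<open>m \<le> l\<close> by simp
    have "m = l - 1"
    proof (rule ccontr)
      assume "m \<noteq> l - 1"
      then have "\<tau> (l - 1) < \<tau> m" using anti[of m "l - 1"] \<open>m < l\<close> l by auto
      then show False using m t by auto
    qed
    then have t_eq: "t = \<tau> m" and l_eq: "l = Suc m" using m t l by auto
    have "\<tau> m < \<tau> (m - 1)" using anti[of "m - 1" m] m by auto
    then have "theta \<tau> m t = 1" "theta \<tau> l t = 0" by (simp_all add: theta_def t_eq l_eq)
    then have "d_piece f \<xi> q \<tau> m x t = d_piece f \<xi> q \<tau> l x t" by (simp add: d_piece_def l_eq)
    then show ?thesis by (simp add: d_map_def m_def)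
  qed
qed

end

theory Submission
  imports Defs
begin

text \<open>The homotopy extends to a continuously differentiable map \<open>H\<close> for all real \<open>t\<close>, and the
  generalized cross product of the rows of its Jacobian is a continuous vector field that spans the
  kernel of the Jacobian at the regular zeros of \<open>H\<close>. This field is only continuous, but the
  inverse function theorem makes its integral curves in the zero set locally unique, hence there is
  a maximal integral curve from \<open>(x0, 1)\<close>. It starts downwards and \<open>x0\<close> is the only zero on the
  level \<open>t = 1\<close>, where every curve crosses downwards, so the curve never returns to its start. A
  maximal curve that accumulates at a regular zero would be periodic, thus the curve leaves every
  compact set of regular zeros. As the outward condition confines all zeros to \<open>X\<close>, the curve
  can only approach \<open>t = 0\<close>; it reaches this level at a finite parameter if the zeros there
  are regular as well.\<close>

section \<open>The oriented kernel of the derivative\<close>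

text \<open>What saves uniqueness is that the zero set is one-dimensional. Near a regular zero it is
  a curve parametrized by its height in the direction of the field, and motion along it is a scalar
  equation with positive continuous speed, solved by separation of variables.

  The squared sine matters because its derivative vanishes at both ends of a switch, so that
  consecutive pieces have matching derivatives in \<open>t\<close>. The start lies outside the range
  of assumed regularity; there the explicit form \<open>t *\<^sub>R (x - x0)\<close> for
  \<open>t \<ge> 1\<close> determines the derivative and the orientation.

  At \<open>t = 0\<close> nothing similar is available: a priori the curve may approach this level
  without converging, by oscillating along a continuum of solutions. Compactness still yields a
  cluster point, which is taken as the end point; continuity there is a separate matter, settled by
  isolation of the solution or by regularity on level \<open>0\<close>.\<close>

definition coord_vec :: "'n option \<Rightarrow> (real^'n) \<times> real" where
  "coord_vec j = (case j of Some k \<Rightarrow> (axis k 1, 0) | None \<Rightarrow> (0, 1))"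

text \<open>Determinants require a square matrix over one index type, whereas the domain is a
  product; this isomorphism identifies the two, with the coordinates ordered like the columns of
  \<open>jacobian_xt\<close>.\<close>

definition of_coords :: "real^('n option) \<Rightarrow> (real^'n) \<times> real" where
  "of_coords z = (\<chi> k. z $ Some k, z $ None)"

lemma surj_of_coords: "surj (of_coords :: real^('n option) \<Rightarrow> (real^'n) \<times> real)"
proof (rule surjI)
  fix p :: "(real^'n) \<times> real"
  show "of_coords (\<chi> j. case j of Some k \<Rightarrow> fst p $ k | None \<Rightarrow> snd p) = p"
    by (simp add: of_coords_def prod_eq_iff vec_eq_iff)
qed

lemma sum_option: "sum g (UNIV :: 'n::finite option set) = g None + (\<Sum>k\<in>UNIV. g (Some k))"
  by (simp add: UNIV_option_conv sum.reindex)

lemma of_coords_eq_sum: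
  fixes z :: "real^('n::finite option)"
  shows "of_coords z = (\<Sum>j\<in>UNIV. z $ j *\<^sub>R coord_vec j)"
proof -
  have "(\<Sum>k\<in>UNIV. z $ Some k *\<^sub>R (axis k 1 :: real^'n)) = (\<chi> k. z $ Some k)"
    using basis_expansion[of "\<chi> k. z $ Some k"] by (simp add: scalar_mult_eq_scaleR)
  then show ?thesis
    by (simp add: sum_option coord_vec_def of_coords_def prod_eq_iff fst_sum snd_sum)
qed

lemma linear_of_coords:
  fixes z :: "real^('n::finite option)"
  assumes "linear T"
  shows "T (of_coords z) = (\<Sum>j\<in>UNIV. z $ j *\<^sub>R T (coord_vec j))"
  by (simp add: of_coords_eq_sum linear_sum[OF assms] linear_cmul[OF assms])

text \<open>The square matrix of the map \<open>\<lambda>z. (A z, w \<bullet> z)\<close> in these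
  coordinates.\<close>

definition bordered :: "((real^'n) \<times> real \<Rightarrow> real^'n) \<Rightarrow> (real^'n) \<times> real \<Rightarrow> real^('n option)^('n option)" where
  "bordered A w = (\<chi> i j. case i of Some k \<Rightarrow> A (coord_vec j) $ k | None \<Rightarrow> w \<bullet> coord_vec j)"

lemma bordered_mult:
  fixes A :: "(real^'n) \<times> real \<Rightarrow> real^'n"
  assumes "linear A"
  shows "bordered A w *v z = (\<chi> i. case i of Some k \<Rightarrow> A (of_coords z) $ k | None \<Rightarrow> w \<bullet> of_coords z)"
  by (auto simp: vec_eq_iff matrix_vector_mult_def bordered_def linear_of_coords[OF assms]
      of_coords_eq_sum[of z] linear_sum[OF assms] linear_cmul[OF assms] inner_sum_right mult.commute
      split: option.splits)

text \<open>The generalized cross product of the rows of \<open>A\<close>. Its coordinates are the signed maximal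
  minors, so it spans the kernel of a surjective \<open>A\<close>, depends continuously on \<open>A\<close> and thereby
  orients all the kernels consistently.\<close>

definition cross_rows :: "((real^'n) \<times> real \<Rightarrow> real^'n) \<Rightarrow> (real^'n) \<times> real" where
  "cross_rows A = (\<Sum>j\<in>UNIV. det (bordered A (coord_vec j)) *\<^sub>R coord_vec j)"

lemma inner_coord_vec_expand:
  "w = (\<Sum>j\<in>UNIV. (w \<bullet> coord_vec j) *\<^sub>R (coord_vec j :: (real^'n) \<times> real))"
proof -
  obtain z where "w = of_coords z" using surj_of_coords by (metis surjD)
  moreover have "of_coords z \<bullet> coord_vec j = z $ j" for j
    by (cases j) (simp_all add: coord_vec_def of_coords_def inner_axis)
  ultimately show ?thesis by (simp add: of_coords_eq_sum)
qed

text \<open>The determinant is linear in the row \<open>None\<close>, and \<open>cross_rows\<close>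
  collects its values for the basis vectors \<open>coord_vec j\<close> in that row. This is the
  universal property of the generalized cross product.\<close>

lemma det_bordered: "det (bordered A w) = cross_rows A \<bullet> w"
proof -
  let ?c = "\<lambda>i. \<chi> j. case i of Some k \<Rightarrow> A (coord_vec j) $ k | None \<Rightarrow> 0"
  let ?a = "\<lambda>m. (\<chi> j. coord_vec m \<bullet> coord_vec j) :: real^('a option)"
  have b: "bordered A (\<Sum>m\<in>UNIV. c m *\<^sub>R coord_vec m)
      = (\<chi> i. if i = None then \<Sum>m\<in>UNIV. c m *s ?a m else ?c i)" for c
    by (auto simp: vec_eq_iff bordered_def inner_sum_left split: option.splits)
  have b1: "bordered A (coord_vec m) = (\<chi> i. if i = None then ?a m else ?c i)" for m
    by (auto simp: vec_eq_iff bordered_def split: option.splits)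
  have "det (bordered A (\<Sum>m\<in>UNIV. c m *\<^sub>R coord_vec m)) = (\<Sum>m\<in>UNIV. c m * det (bordered A (coord_vec m)))" for c
    unfolding b b1 by (subst det_linear_row_sum) (simp_all add: det_row_mul)
  from this[of "\<lambda>j. w \<bullet> coord_vec j"] show ?thesis
    unfolding inner_coord_vec_expand[of w, symmetric]
    by (simp add: cross_rows_def inner_sum_left inner_sum_right inner_commute mult.commute)
qed

text \<open>Component \<open>k\<close> of the image is the inner product of
  \<open>cross_rows A\<close> with row \<open>k\<close> of \<open>A\<close>, hence a determinant in
  which this row occurs twice.\<close>

lemma cross_rows_in_kernel:
  assumes "linear A"
  shows "A (cross_rows A) = 0"
proof -
  have "A (cross_rows A) $ k = 0" for k
  proof -
    define r where "r = of_coords (\<chi> j. A (coord_vec j) $ k)"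
    have rc: "r \<bullet> coord_vec j = A (coord_vec j) $ k" for j
      by (cases j) (simp_all add: r_def coord_vec_def of_coords_def inner_axis)
    have "A (cross_rows A) $ k = cross_rows A \<bullet> r"
      by (simp add: cross_rows_def linear_sum[OF assms] linear_cmul[OF assms] inner_sum_left
          rc inner_commute[of "coord_vec _" r])
    also have "\<dots> = det (bordered A r)" by (simp add: det_bordered)
    also have "\<dots> = 0"
      by (rule det_identical_rows[of "Some k" None]) (simp_all add: row_def bordered_def rc)
    finally show ?thesis .
  qed
  then show ?thesis by (simp add: vec_eq_iff)
qed

text \<open>A preimage under \<open>A\<close> can be moved along the kernel vector \<open>w\<close>,
  which corrects its inner product with \<open>w\<close> without changing its image. Injectivity
  then comes from equal dimensions.\<close>

lemma bij_kernel_augmented: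
  fixes A :: "(real^'n) \<times> real \<Rightarrow> real^'n"
  assumes A: "linear A" "surj A" and w: "w \<noteq> 0" "A w = 0"
  shows "bij (\<lambda>z. (A z, w \<bullet> z))"
proof -
  have lin: "linear (\<lambda>z. (A z, w \<bullet> z))"
    using A(1) by (simp add: linear_iff inner_add_right)
  have "surj (\<lambda>z. (A z, w \<bullet> z))"
    unfolding surj_def
  proof (intro allI)
    fix y :: "(real^'n) \<times> real"
    obtain z where z: "A z = fst y" using A(2) by (metis surjD)
    have "(A (z + ((snd y - w \<bullet> z) / (w \<bullet> w)) *\<^sub>R w), w \<bullet> (z + ((snd y - w \<bullet> z) / (w \<bullet> w)) *\<^sub>R w)) = y"
      using w z by (simp add: linear_add[OF A(1)] linear_cmul[OF A(1)] inner_add_right prod_eq_iff)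
    then show "\<exists>z. y = (A z, w \<bullet> z)" by metis
  qed
  then show ?thesis
    using linear_surjective_imp_injective[OF lin] by (simp add: bij_def)
qed

text \<open>Bordering \<open>A\<close> with a nonzero kernel vector \<open>w\<close> gives an
  invertible matrix, and its determinant is \<open>cross_rows A \<bullet> w\<close>.\<close>

lemma cross_rows_nonzero:
  fixes A :: "(real^'n) \<times> real \<Rightarrow> real^'n"
  assumes A: "linear A" "surj A"
  shows "cross_rows A \<noteq> 0"
proof -
  have "\<not> inj A"
  proof
    assume "inj A"
    then have "dim (range A) = dim (UNIV :: ((real^'n) \<times> real) set)"
      by (intro dim_image_eq[OF A(1)]) simp
    with A(2) show False by simp
  qed
  then obtain w where w: "w \<noteq> 0" "A w = 0"
    using linear_injective_0[OF A(1)] by blast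
  have "surj ((*v) (bordered A w))"
    unfolding surj_def
  proof (intro allI)
    fix y :: "real^('n option)"
    obtain u where u: "A u = (\<chi> k. y $ Some k)" "w \<bullet> u = y $ None"
      using surjD[OF bij_is_surj[OF bij_kernel_augmented[OF A w]], of "(\<chi> k. y $ Some k, y $ None)"] by auto
    obtain z where "u = of_coords z" using surj_of_coords by (metis surjD)
    with u show "\<exists>z. y = bordered A w *v z"
      by (auto simp: bordered_mult[OF A(1)] vec_eq_iff intro!: exI[of _ z] split: option.splits)
  qed
  then have "det (bordered A w) \<noteq> 0"
    by (metis invertible_det_nz invertible_right_inverse matrix_right_invertible_surjective)
  then show ?thesis by (auto simp: det_bordered)
qed

text \<open>For the converse, \<open>A\<close> is bordered with \<open>cross_rows A\<close> itself,
  which makes the determinant its squared norm.\<close>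

lemma cross_rows_nonzero_iff:
  fixes A :: "(real^'n) \<times> real \<Rightarrow> real^'n"
  assumes "linear A"
  shows "cross_rows A \<noteq> 0 \<longleftrightarrow> surj A"
proof
  let ?B = "bordered A (cross_rows A)"
  assume "cross_rows A \<noteq> 0"
  then have "det ?B \<noteq> 0"
    by (simp add: det_bordered)
  then have surj_B: "surj ((*v) ?B)"
    by (metis invertible_det_nz invertible_right_inverse matrix_right_invertible_surjective)
  show "surj A"
    unfolding surj_def
  proof
    fix y :: "real^'n"
    obtain z where "?B *v z = (\<chi> i. case i of Some k \<Rightarrow> y $ k | None \<Rightarrow> 0)"
      using surj_B by (metis surjD)
    then have "y = A (of_coords z)"
      by (auto simp: bordered_mult[OF assms] vec_eq_iff split: option.splits dest: spec[of _ "Some _"])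
    then show "\<exists>x. y = A x" ..
  qed
qed (rule cross_rows_nonzero[OF assms])

lemma continuous_on_det:
  fixes M :: "'a::topological_space \<Rightarrow> real^'m^'m"
  assumes "\<And>i j. continuous_on S (\<lambda>x. M x $ i $ j)"
  shows "continuous_on S (\<lambda>x. det (M x))"
  unfolding det_def by (intro continuous_intros assms)

lemma continuous_on_cross_rows:
  assumes "continuous_on S A"
  shows "continuous_on S (\<lambda>p. cross_rows (blinfun_apply (A p)))"
proof -
  have "continuous_on S (\<lambda>p. bordered (blinfun_apply (A p)) w $ i $ j)" for w i j
    unfolding bordered_def by (cases i) (auto intro!: continuous_intros assms)
  then show ?thesis
    unfolding cross_rows_def by (intro continuous_on_sum continuous_on_scaleR continuous_on_det continuous_on_const)
qed

lemma full_rank_iff_surj_derivative: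
  fixes A :: "(real^'n) \<times> real \<Rightarrow> real^'n"
  assumes "linear A"
  shows "rank ((\<chi> i j. A (coord_vec j) $ i) :: real^('n option)^'n) = CARD('n) \<longleftrightarrow> surj A"
proof -
  have "(*v) ((\<chi> i j. A (coord_vec j) $ i) :: real^('n option)^'n) = A \<circ> of_coords"
    by (auto simp: fun_eq_iff vec_eq_iff matrix_vector_mult_def linear_of_coords[OF assms] mult.commute)
  then show ?thesis
    unfolding full_rank_surjective
    using surj_of_coords by (metis comp_surj fun.set_map image_comp)
qed

section \<open>Flow boxes on the zero set\<close>

text \<open>Derivatives relative to \<open>I\<close> are one-sided at the ends of a closed interval,
  which is what gluing curves end to end requires.\<close>

definition integral_curve :: "'a::real_normed_vector set \<Rightarrow> ('a \<Rightarrow> 'a) \<Rightarrow> (real \<Rightarrow> 'a) \<Rightarrow> real set \<Rightarrow> bool" where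
  "integral_curve M v \<alpha> I \<longleftrightarrow>
     (\<forall>s\<in>I. \<alpha> s \<in> M \<and> (\<alpha> has_vector_derivative v (\<alpha> s)) (at s within I))"

text \<open>The function \<open>\<sigma>\<close> is a local clock: it advances at unit speed along every integral curve.
  Curves through \<open>U\<close> are thus determined by their clock reading. The factor \<open>1/2\<close> leaves
  room for following such a curve beyond \<open>U\<close>.\<close>

definition flow_box ::
    "'a::real_normed_vector set \<Rightarrow> ('a \<Rightarrow> 'a) \<Rightarrow> 'a set \<Rightarrow> ('a \<Rightarrow> real) \<Rightarrow> (real \<Rightarrow> 'a) \<Rightarrow> real \<Rightarrow> bool" where
  "flow_box M v U \<sigma> c \<delta> \<longleftrightarrow>
     open U \<and> \<delta> > 0 \<and> integral_curve M v c {-\<delta><..<\<delta>} \<and>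
     (\<forall>q\<in>M \<inter> U. \<bar>\<sigma> q\<bar> < \<delta> / 2 \<and> c (\<sigma> q) = q) \<and>
     (\<forall>\<alpha> S s. s \<in> S \<longrightarrow> \<alpha> s \<in> M \<inter> U \<longrightarrow> (\<alpha> has_vector_derivative v (\<alpha> s)) (at s within S) \<longrightarrow>
        ((\<lambda>s. \<sigma> (\<alpha> s)) has_real_derivative 1) (at s within S))"

text \<open>Separation of variables: \<open>G y\<close> is the time needed to get from
  \<open>y0\<close> to \<open>y\<close> at speed \<open>1 / k\<close>, and its inverse
  \<open>K\<close> is the motion itself.\<close>

lemma integral_clock:
  fixes k :: "real \<Rightarrow> real"
  assumes e: "0 < e" and cont: "continuous_on {y0 - e<..<y0 + e} k"
    and pos: "\<And>y. \<bar>y - y0\<bar> < e \<Longrightarrow> 0 < k y"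
  obtains G K a b \<delta> where "y0 - e < a" "a < y0" "y0 < b" "b < y0 + e" "0 < \<delta>"
    "\<And>y. y \<in> {a..b} \<Longrightarrow> (G has_real_derivative k y) (at y)"
    "strict_mono_on {a..b} G" "G y0 = 0"
    "\<And>y. y \<in> {a..b} \<Longrightarrow> K (G y) = y"
    "\<And>s. \<bar>s\<bar> < \<delta> \<Longrightarrow> K s \<in> {a<..<b} \<and> G (K s) = s \<and> (K has_real_derivative inverse (k (K s))) (at s)"
proof -
  \<comment> \<open>The antiderivative lives on a closed interval of radius \<open>e / 2\<close>,
    with one-sided derivatives at its ends; the smaller radius \<open>e / 3\<close> makes all
    derivatives on \<open>{a..b}\<close> two-sided.\<close>
  define a b where "a = y0 - e / 3" and "b = y0 + e / 3"
  have ab: "y0 - e < a" "a < y0" "y0 < b" "b < y0 + e"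
    using e by (auto simp: a_def b_def)
  have "continuous_on {y0 - e / 2..y0 + e / 2} k"
    by (rule continuous_on_subset[OF cont]) (use e in auto)
  then obtain G1 where G1: "\<And>y. y \<in> {y0 - e / 2..y0 + e / 2} \<Longrightarrow>
      (G1 has_vector_derivative k y) (at y within {y0 - e / 2..y0 + e / 2})"
    by (rule antiderivative_continuous) (rule that)
  define G where "G = (\<lambda>y. G1 y - G1 y0)"
  have G': "(G has_real_derivative k y) (at y)" if "y \<in> {a..b}" for y
  proof -
    have "y \<in> {y0 - e / 2<..<y0 + e / 2}"
      using that e by (auto simp: a_def b_def)
    moreover from this have "(G1 has_vector_derivative k y) (at y within {y0 - e / 2<..<y0 + e / 2})"
      by (intro has_vector_derivative_within_subset[OF G1]) auto
    ultimately have "(G1 has_vector_derivative k y) (at y)"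
      by (simp add: at_within_open[OF _ open_greaterThanLessThan])
    then show ?thesis
      unfolding G_def
      by (auto simp: has_real_derivative_iff_has_vector_derivative has_vector_derivative_diff_const)
  qed
  have mono: "strict_mono_on {a..b} G"
  proof (rule strict_mono_onI)
    fix r s assume rs: "r \<in> {a..b}" "s \<in> {a..b}" "r < s"
    show "G r < G s"
    proof (rule DERIV_pos_imp_increasing[OF rs(3)])
      fix x assume "r \<le> x" "x \<le> s"
      then have "x \<in> {a..b}" "\<bar>x - y0\<bar> < e"
        using rs ab by auto
      then show "\<exists>y. (G has_real_derivative y) (at x) \<and> 0 < y"
        using G' pos by blast
    qed
  qed
  define K where "K = inv_into {a..b} G"
  have KG: "K (G y) = y" if "y \<in> {a..b}" for y
    unfolding K_def by (rule inv_into_f_f[OF strict_mono_on_imp_inj_on[OF mono] that])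
  have cont_G: "isCont G y" if "y \<in> {a..b}" for y
    using G'[OF that] by (rule DERIV_isCont)
  have "G y0 = 0"
    by (simp add: G_def)
  moreover have "G a < G y0" "G y0 < G b"
    using ab by (auto intro!: strict_mono_onD[OF mono])
  ultimately have G_ab: "G a < 0" "0 < G b"
    by auto
  \<comment> \<open>Both \<open>G a\<close> and \<open>G b\<close> are at least this far from
    \<open>0\<close>, so by the intermediate value theorem every time of modulus below
    \<open>\<delta>\<close> is attained strictly inside \<open>{a..b}\<close>.\<close>
  define \<delta> where "\<delta> = min (- G a) (G b)"
  have "0 < \<delta>"
    using G_ab by (simp add: \<delta>_def)
  have K_in: "K s \<in> {a<..<b} \<and> G (K s) = s" if "\<bar>s\<bar> < \<delta>" for s
  proof -
    have "\<exists>y\<ge>a. y \<le> b \<and> G y = s"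
      using that ab cont_G by (intro IVT) (auto simp: \<delta>_def)
    then obtain y where y: "a \<le> y" "y \<le> b" "G y = s"
      by auto
    moreover have "y \<noteq> a" "y \<noteq> b"
      using y that by (auto simp: \<delta>_def)
    ultimately show ?thesis
      using KG[of y] by auto
  qed
  have K': "(K has_real_derivative inverse (k (K s))) (at s)" if s: "\<bar>s\<bar> < \<delta>" for s
  proof (rule DERIV_inverse_function[where a = "-\<delta>" and b = \<delta> and f = G])
    show "(G has_real_derivative k (K s)) (at (K s))"
      using K_in[OF s] by (intro G') auto
    show "k (K s) \<noteq> 0"
      using pos[of "K s"] K_in[OF s] ab by (auto simp: abs_less_iff)
    have "isCont K (G (K s))"
      by (rule isCont_inverse_function2[of a _ b]) (use K_in[OF s] in \<open>auto simp: KG cont_G\<close>)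
    then show "isCont K s"
      using K_in[OF s] by simp
    show "-\<delta> < s" "s < \<delta>"
      using s by auto
    show "G (K y) = y" if "-\<delta> < y" "y < \<delta>" for y
      using K_in[of y] that by (simp add: abs_less_iff)
  qed
  show thesis
    by (rule that[of a b \<delta> G K]) (use ab \<open>0 < \<delta>\<close> G' mono \<open>G y0 = 0\<close> KG K_in K' in auto)
qed

text \<open>Completing \<open>h\<close> by the height \<open>v0 \<bullet> q\<close> gives a local
  diffeomorphism \<open>\<Phi>\<close>, so the zeros near \<open>p\<close> form a curve
  \<open>b\<close> parametrized by height. An integral curve of \<open>v\<close> climbs along
  \<open>b\<close> at the speed \<open>w\<close>, and integrating \<open>1 / w\<close> turns height
  into the clock.\<close>

lemma flow_box_exists:
  fixes h :: "(real^'n) \<times> real \<Rightarrow> real^'n"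
    and h' :: "(real^'n) \<times> real \<Rightarrow> ((real^'n) \<times> real) \<Rightarrow>\<^sub>L (real^'n)"
    and v :: "(real^'n) \<times> real \<Rightarrow> (real^'n) \<times> real"
  defines "M \<equiv> {p. h p = 0 \<and> v p \<noteq> 0}"
  assumes deriv: "\<And>p. (h has_derivative blinfun_apply (h' p)) (at p)"
    and cont: "continuous_on UNIV h'" and cont_v: "continuous_on UNIV v"
    and kernel: "\<And>q. h' q (v q) = 0" and surj: "\<And>q. v q \<noteq> 0 \<Longrightarrow> surj (blinfun_apply (h' q))"
    and p: "p \<in> M"
  obtains U \<sigma> c \<delta> where "p \<in> U" "flow_box M v U \<sigma> c \<delta>"
proof -
  have lin: "linear (blinfun_apply (h' q))" for q
    by (simp add: blinfun.bounded_linear_right bounded_linear.linear)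
  define v0 where "v0 = v p"
  \<comment> \<open>Here the field is transversal to the level sets of the height, which keeps the
    speed \<open>w\<close> below positive.\<close>
  define Q where "Q = {q. 0 < v0 \<bullet> v q}"
  have open_Q: "open Q"
    unfolding Q_def by (intro open_Collect_less continuous_intros cont_v)
  have p_Q: "p \<in> Q"
    using p by (simp add: Q_def v0_def M_def)
  define \<Phi> where "\<Phi> = (\<lambda>q. (h q, v0 \<bullet> q))"
  define \<Phi>' where "\<Phi>' = (\<lambda>q. Blinfun (\<lambda>z. (h' q z, v0 \<bullet> z)))"
  have "bounded_linear (\<lambda>z. (h' q z, v0 \<bullet> z))" for q
    by (intro bounded_linear_intros)
  then have \<Phi>'_apply: "blinfun_apply (\<Phi>' q) = (\<lambda>z. (h' q z, v0 \<bullet> z))" for q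
    by (simp add: \<Phi>'_def bounded_linear_Blinfun_apply)
  have \<Phi>_deriv: "(\<Phi> has_derivative blinfun_apply (\<Phi>' q)) (at q)" for q
    unfolding \<Phi>_def \<Phi>'_apply by (intro derivative_intros deriv)
  have cont_\<Phi>': "continuous_on Q \<Phi>'"
    by (rule continuous_on_blinfun_componentwise)
      (auto simp: \<Phi>'_apply intro!: continuous_intros continuous_on_subset[OF cont])
  have "surj (blinfun_apply (h' p))" "v0 \<noteq> 0"
    using p surj by (auto simp: M_def v0_def)
  then have "inj (blinfun_apply (\<Phi>' p))"
    unfolding \<Phi>'_apply using bij_kernel_augmented[OF lin, of p v0] kernel[of p]
    by (auto simp: v0_def bij_def)
  moreover have "linear (blinfun_apply (\<Phi>' p))"
    by (simp add: blinfun.bounded_linear_right bounded_linear.linear)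
  ultimately obtain j where j: "linear j" "\<And>z. j (\<Phi>' p z) = z"
    using linear_injective_left_inverse[of "blinfun_apply (\<Phi>' p)"] by (auto simp: fun_eq_iff)
  have "Blinfun j o\<^sub>L \<Phi>' p = id_blinfun"
    using j by (auto intro!: blinfun_eqI simp: bounded_linear_Blinfun_apply linear_conv_bounded_linear)
  then obtain U' V g g' where U': "open U'" "U' \<subseteq> Q" "p \<in> U'" and V: "open V" "\<Phi> p \<in> V"
    and hom: "homeomorphism U' V \<Phi> g"
    and g': "\<And>y. y \<in> V \<Longrightarrow> (g has_derivative (g' y)) (at y)"
    and g'_inv: "\<And>y. y \<in> V \<Longrightarrow> g' y = inv (blinfun_apply (\<Phi>'(g y)))"
    and bij: "\<And>y. y \<in> V \<Longrightarrow> bij (blinfun_apply (\<Phi>'(g y)))"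
    by (rule inverse_function_theorem[OF open_Q \<Phi>_deriv cont_\<Phi>' p_Q]) blast+
  define y0 where "y0 = v0 \<bullet> p"
  have "\<Phi> p = (0, y0)"
    using p by (simp add: \<Phi>_def y0_def M_def)
  with V obtain e where e: "0 < e" "ball (0, y0) e \<subseteq> V"
    using open_contains_ball by metis
  have in_V: "(0, y) \<in> V" if "\<bar>y - y0\<bar> < e" for y
    using that e(2) by (auto simp: dist_Pair_Pair dist_real_def abs_minus_commute)
  define b where "b = (\<lambda>y. g (0, y))"
  have b_Q: "b y \<in> Q" and h_b: "h (b y) = 0" and v0_b: "v0 \<bullet> b y = y" if "\<bar>y - y0\<bar> < e" for y
  proof -
    have "b y \<in> U'" "\<Phi> (b y) = (0, y)"
      using homeomorphism_image2[OF hom] homeomorphism_apply2[OF hom] in_V[OF that]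
      by (auto simp: b_def)
    then show "b y \<in> Q" "h (b y) = 0" "v0 \<bullet> b y = y"
      using U'(2) by (auto simp: \<Phi>_def)
  qed
  define w where "w = (\<lambda>y. v0 \<bullet> v (b y))"
  have w_pos: "0 < w y" if "\<bar>y - y0\<bar> < e" for y
    using b_Q[OF that] by (simp add: Q_def w_def)
  have b_deriv: "(b has_vector_derivative (1 / w y) *\<^sub>R v (b y)) (at y)" if y: "\<bar>y - y0\<bar> < e" for y
  proof -
    have "(g has_derivative g' (0, y)) (at (0, y))"
      by (rule g'[OF in_V[OF y]])
    then have "(b has_derivative (\<lambda>t. g' (0, y) (0, t))) (at y)"
      unfolding b_def
      by (rule has_derivative_compose[rotated, where f = "\<lambda>y. (0, y)"]) (auto intro!: derivative_eq_intros)
    \<comment> \<open>The tangent of \<open>b\<close> is the kernel vector whose height component is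
      \<open>1\<close>, that is \<open>v\<close> divided by its speed \<open>w\<close>; inverting
      \<open>\<Phi>'\<close> is replaced by checking this candidate.\<close>
    moreover have "g' (0, y) (0, t) = t *\<^sub>R (1 / w y) *\<^sub>R v (b y)" for t
    proof -
      have "\<Phi>' (b y) (t *\<^sub>R (1 / w y) *\<^sub>R v (b y)) = (0, t)"
        using w_pos[OF y] by (simp add: \<Phi>'_apply blinfun.scaleR_right kernel) (simp add: w_def)
      then show ?thesis
        using bij[OF in_V[OF y]] g'_inv[OF in_V[OF y]] by (metis b_def bij_inv_eq_iff)
    qed
    ultimately show ?thesis
      by (simp add: has_vector_derivative_def)
  qed
  have "isCont b y" if "\<bar>y - y0\<bar> < e" for y
    using b_deriv[OF that] by (rule has_vector_derivative_continuous)
  then have "continuous_on {y0 - e<..<y0 + e} b"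
    by (intro continuous_at_imp_continuous_on) auto
  then have "continuous_on {y0 - e<..<y0 + e} w"
    unfolding w_def by (intro continuous_intros continuous_on_compose2[OF cont_v]) auto
  then have "continuous_on {y0 - e<..<y0 + e} (\<lambda>y. 1 / w y)"
  proof (rule continuous_on_divide[OF continuous_on_const])
    show "\<forall>y\<in>{y0 - e<..<y0 + e}. w y \<noteq> 0"
    proof
      fix y assume "y \<in> {y0 - e<..<y0 + e}"
      then have "0 < w y" by (intro w_pos) auto
      then show "w y \<noteq> 0" by simp
    qed
  qed
  then obtain G K a a' \<delta> where a: "y0 - e < a" "a < y0" "y0 < a'" "a' < y0 + e" and \<delta>: "0 < \<delta>"
    and G': "\<And>y. y \<in> {a..a'} \<Longrightarrow> (G has_real_derivative 1 / w y) (at y)"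
    and mono: "strict_mono_on {a..a'} G" and G0: "G y0 = 0"
    and KG: "\<And>y. y \<in> {a..a'} \<Longrightarrow> K (G y) = y"
    and K: "\<And>s. \<bar>s\<bar> < \<delta> \<Longrightarrow>
      K s \<in> {a<..<a'} \<and> G (K s) = s \<and> (K has_real_derivative inverse (1 / w (K s))) (at s)"
    by (rule integral_clock[OF e(1)]) (simp add: w_pos, rule that)
  have in_e: "\<bar>y - y0\<bar> < e" if "y \<in> {a..a'}" for y
    using that a by auto
  \<comment> \<open>The two height bounds are the positions at the times \<open>-\<delta>/2\<close>
    and \<open>\<delta>/2\<close>, which confines the clock readings on \<open>U\<close> to half of
    the range of the curve.\<close>
  define U where "U = U' \<inter> {q. K (-\<delta>/2) < v0 \<bullet> q} \<inter> {q. v0 \<bullet> q < K (\<delta>/2)}"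
  have K_half: "K (-\<delta>/2) \<in> {a<..<a'}" "K (\<delta>/2) \<in> {a<..<a'}" "G (K (-\<delta>/2)) = -\<delta>/2" "G (K (\<delta>/2)) = \<delta>/2"
    using K[of "-\<delta>/2"] K[of "\<delta>/2"] \<delta> by auto
  have G_less: "G x < G y \<longleftrightarrow> x < y" if "x \<in> {a..a'}" "y \<in> {a..a'}" for x y
    using strict_mono_on_less[OF mono] that by simp
  have U_in: "v0 \<bullet> q \<in> {a..a'}" if "q \<in> U" for q
    using that K_half by (auto simp: U_def)
  have b_U: "b (v0 \<bullet> q) = q" if "q \<in> M \<inter> U" for q
  proof -
    have "\<Phi> q = (0, v0 \<bullet> q)" "q \<in> U'"
      using that by (auto simp: M_def \<Phi>_def U_def)
    then show ?thesis
      using homeomorphism_apply1[OF hom, of q] by (simp add: b_def)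
  qed
  show thesis
  proof (rule that)
    have "K (-\<delta>/2) < y0" "y0 < K (\<delta>/2)"
      using G_less[of "K (-\<delta>/2)" y0] G_less[of y0 "K (\<delta>/2)"] K_half G0 \<delta> a by auto
    then show "p \<in> U"
      using U' by (auto simp: U_def y0_def)
    show "flow_box M v U (\<lambda>q. G (v0 \<bullet> q)) (\<lambda>s. b (K s)) \<delta>"
      unfolding flow_box_def
    proof (intro conjI ballI allI impI)
      show "open U"
        unfolding U_def by (intro open_Int U'(1) open_Collect_less continuous_intros)
      show "integral_curve M v (\<lambda>s. b (K s)) {-\<delta><..<\<delta>}"
        unfolding integral_curve_def
      proof (intro ballI conjI)
        fix s assume s: "s \<in> {-\<delta><..<\<delta>}"
        then have "\<bar>s\<bar> < \<delta>"
          by auto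
        note Ks = K[OF this]
        have Ks_e: "\<bar>K s - y0\<bar> < e"
          using Ks by (intro in_e) auto
        have "v (b (K s)) \<noteq> 0"
          using w_pos[OF Ks_e] by (auto simp: w_def)
        then show "b (K s) \<in> M"
          using h_b[OF Ks_e] by (simp add: M_def)
        \<comment> \<open>\<open>K\<close> moves at the speed \<open>w\<close> and \<open>b\<close>
          has the velocity \<open>v / w\<close>, so the factors cancel.\<close>
        have "((b \<circ> K) has_vector_derivative inverse (1 / w (K s)) *\<^sub>R (1 / w (K s)) *\<^sub>R v (b (K s))) (at s)"
          using Ks b_deriv[OF Ks_e]
          by (intro vector_diff_chain_at) (auto simp: has_real_derivative_iff_has_vector_derivative)
        then have "((\<lambda>s. b (K s)) has_vector_derivative v (b (K s))) (at s)"
          using w_pos[OF Ks_e] by (simp add: o_def)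
        then show "((\<lambda>s. b (K s)) has_vector_derivative v (b (K s))) (at s within {-\<delta><..<\<delta>})"
          by (rule has_vector_derivative_at_within)
      qed
      fix q assume q: "q \<in> M \<inter> U"
      then show "\<bar>G (v0 \<bullet> q)\<bar> < \<delta> / 2"
        using G_less[of "K (-\<delta>/2)" "v0 \<bullet> q"] G_less[of "v0 \<bullet> q" "K (\<delta>/2)"] K_half U_in[of q]
        by (auto simp: U_def abs_less_iff)
      show "b (K (G (v0 \<bullet> q))) = q"
        using q U_in[of q] b_U[OF q] KG by simp
    next
      fix \<alpha> :: "real \<Rightarrow> (real^'n) \<times> real" and S s
      assume \<alpha>: "s \<in> S" "\<alpha> s \<in> M \<inter> U" "(\<alpha> has_vector_derivative v (\<alpha> s)) (at s within S)"
      have in_a: "v0 \<bullet> \<alpha> s \<in> {a..a'}"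
        using \<alpha> U_in by auto
      have w: "w (v0 \<bullet> \<alpha> s) = v0 \<bullet> v (\<alpha> s)"
        by (simp add: w_def b_U[OF \<alpha>(2)])
      have "((\<lambda>s. v0 \<bullet> \<alpha> s) has_real_derivative v0 \<bullet> v (\<alpha> s)) (at s within S)"
        using bounded_linear.has_vector_derivative[OF bounded_linear_inner_right \<alpha>(3), of v0]
        by (simp add: has_real_derivative_iff_has_vector_derivative)
      then have "((G \<circ> (\<lambda>s. v0 \<bullet> \<alpha> s)) has_real_derivative 1 / w (v0 \<bullet> \<alpha> s) * (v0 \<bullet> v (\<alpha> s))) (at s within S)"
        by (intro DERIV_image_chain has_field_derivative_at_within[OF G'[OF in_a]])
      then show "((\<lambda>s. G (v0 \<bullet> \<alpha> s)) has_real_derivative 1) (at s within S)"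
        using w_pos[OF in_e[OF in_a]] by (simp add: w o_def)
    qed (rule \<delta>)
  qed
qed

section \<open>Maximal integral curves\<close>

lemma integral_curve_mem: "integral_curve M v \<alpha> I \<Longrightarrow> s \<in> I \<Longrightarrow> \<alpha> s \<in> M"
  by (simp add: integral_curve_def)

lemma integral_curve_derivative:
  "integral_curve M v \<alpha> I \<Longrightarrow> s \<in> I \<Longrightarrow> (\<alpha> has_vector_derivative v (\<alpha> s)) (at s within I)"
  by (simp add: integral_curve_def)

lemma integral_curve_subset: "integral_curve M v \<alpha> I \<Longrightarrow> I' \<subseteq> I \<Longrightarrow> integral_curve M v \<alpha> I'"
  unfolding integral_curve_def by (blast intro: has_vector_derivative_within_subset)

lemma integral_curve_shift:
  assumes "integral_curve M v \<alpha> I"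
  shows "integral_curve M v (\<lambda>s. \<alpha> (s + r)) {s. s + r \<in> I}"
  unfolding integral_curve_def
proof (intro ballI conjI)
  fix s assume "s \<in> {s. s + r \<in> I}"
  then have s: "s + r \<in> I" by simp
  show "\<alpha> (s + r) \<in> M"
    using integral_curve_mem[OF assms s] .
  have "((\<alpha> \<circ> (\<lambda>s. s + r)) has_vector_derivative 1 *\<^sub>R v (\<alpha> (s + r))) (at s within {s. s + r \<in> I})"
  proof (rule vector_diff_chain_within)
    show "((\<lambda>s. s + r) has_vector_derivative 1) (at s within {s. s + r \<in> I})"
      by (auto intro!: derivative_eq_intros)
    show "(\<alpha> has_vector_derivative v (\<alpha> (s + r))) (at (s + r) within (\<lambda>s. s + r) ` {s. s + r \<in> I})"
      by (rule has_vector_derivative_within_subset[OF integral_curve_derivative[OF assms s]]) auto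
  qed
  then show "((\<lambda>s. \<alpha> (s + r)) has_vector_derivative v (\<alpha> (s + r))) (at s within {s. s + r \<in> I})"
    by (simp add: o_def)
qed

lemma integral_curve_cong:
  assumes "integral_curve M v \<alpha> I" "\<And>s. s \<in> I \<Longrightarrow> \<beta> s = \<alpha> s"
  shows "integral_curve M v \<beta> I"
  unfolding integral_curve_def
proof (intro ballI conjI)
  fix s assume s: "s \<in> I"
  show "\<beta> s \<in> M"
    using integral_curve_mem[OF assms(1) s] assms(2)[OF s] by simp
  show "(\<beta> has_vector_derivative v (\<beta> s)) (at s within I)"
    using has_vector_derivative_transform[OF s assms(2) integral_curve_derivative[OF assms(1) s]] assms(2)[OF s]
    by simp
qed

lemma integral_curve_continuous: "integral_curve M v \<alpha> I \<Longrightarrow> continuous_on I \<alpha>"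
  by (rule continuous_on_vector_derivative[where f' = "\<lambda>s. v (\<alpha> s)"]) (rule integral_curve_derivative)

lemma flow_boxD:
  assumes "flow_box M v U \<sigma> c \<delta>"
  shows "open U" "\<delta> > 0" "integral_curve M v c {-\<delta><..<\<delta>}"
    "\<And>q. q \<in> M \<Longrightarrow> q \<in> U \<Longrightarrow> \<bar>\<sigma> q\<bar> < \<delta> / 2" "\<And>q. q \<in> M \<Longrightarrow> q \<in> U \<Longrightarrow> c (\<sigma> q) = q"
    "\<And>\<alpha> S s. s \<in> S \<Longrightarrow> \<alpha> s \<in> M \<Longrightarrow> \<alpha> s \<in> U \<Longrightarrow> (\<alpha> has_vector_derivative v (\<alpha> s)) (at s within S) \<Longrightarrow>
        ((\<lambda>s. \<sigma> (\<alpha> s)) has_real_derivative 1) (at s within S)"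
  using assms by (auto simp: flow_box_def)

text \<open>Flow boxes stand in for a local existence and uniqueness theorem, as the field of the
  application is only continuous.\<close>

locale flow_box_space =
  fixes M :: "'a::real_normed_vector set" and v :: "'a \<Rightarrow> 'a"
  assumes flow_box_at: "p \<in> M \<Longrightarrow> \<exists>U \<sigma> c \<delta>. p \<in> U \<and> flow_box M v U \<sigma> c \<delta>"
begin

text \<open>The parameters of agreement form a clopen subset of the connected \<open>I\<close>.
  Openness comes from the clock: both readings advance at unit speed, so their difference stays
  \<open>0\<close>, and a reading determines the point through \<open>c\<close>.\<close>

lemma integral_curve_unique:
  assumes \<alpha>: "integral_curve M v \<alpha> I" and \<beta>: "integral_curve M v \<beta> I"
    and I: "is_interval I" and u: "u \<in> I" "\<alpha> u = \<beta> u" and s: "s \<in> I"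
  shows "\<alpha> s = \<beta> s"
proof -
  define T where "T = {s \<in> I. \<alpha> s = \<beta> s}"
  note cont = integral_curve_continuous[OF \<alpha>] integral_curve_continuous[OF \<beta>]
  have "closedin (top_of_set I) {s \<in> I. \<alpha> s - \<beta> s = 0}"
    by (intro continuous_closedin_preimage_constant continuous_intros cont)
  then have "closedin (top_of_set I) T"
    by (simp add: T_def)
  moreover have "openin (top_of_set I) T"
    unfolding openin_contains_ball
  proof (intro conjI ballI)
    show "T \<subseteq> I" by (auto simp: T_def)
    fix s1 assume s1: "s1 \<in> T"
    then have s1_I: "s1 \<in> I" "\<beta> s1 = \<alpha> s1" by (auto simp: T_def)
    obtain U \<sigma> c \<delta> where U: "\<alpha> s1 \<in> U" and box: "flow_box M v U \<sigma> c \<delta>"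
      using flow_box_at integral_curve_mem[OF \<alpha> s1_I(1)] by metis
    have "openin (top_of_set I) ((I \<inter> \<alpha> -` U) \<inter> (I \<inter> \<beta> -` U))"
      by (intro openin_Int continuous_openin_preimage_gen cont flow_boxD(1)[OF box])
    moreover have "s1 \<in> (I \<inter> \<alpha> -` U) \<inter> (I \<inter> \<beta> -` U)"
      using s1_I U by auto
    ultimately obtain e where e: "0 < e" "ball s1 e \<inter> I \<subseteq> (I \<inter> \<alpha> -` U) \<inter> (I \<inter> \<beta> -` U)"
      unfolding openin_contains_ball by blast
    define W where "W = ball s1 e \<inter> I"
    have W: "\<alpha> s \<in> U" "\<beta> s \<in> U" "s \<in> I" if "s \<in> W" for s
      using that e(2) by (auto simp: W_def)
    have convex_W: "convex W"
      unfolding W_def using I by (intro convex_Int convex_ball) (simp add: is_interval_convex_1)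
    have \<alpha>_W: "integral_curve M v \<alpha> W" and \<beta>_W: "integral_curve M v \<beta> W"
      using \<alpha> \<beta> by (auto simp: W_def intro: integral_curve_subset)
    have "((\<lambda>s. \<sigma> (\<alpha> s) - \<sigma> (\<beta> s)) has_real_derivative 0) (at s within W)" if "s \<in> W" for s
    proof -
      have "((\<lambda>s. \<sigma> (\<alpha> s) - \<sigma> (\<beta> s)) has_real_derivative 1 - 1) (at s within W)"
        using that W[OF that] integral_curve_mem[OF \<alpha>_W that] integral_curve_mem[OF \<beta>_W that]
          integral_curve_derivative[OF \<alpha>_W that] integral_curve_derivative[OF \<beta>_W that]
        by (intro DERIV_diff flow_boxD(6)[OF box])
      then show ?thesis by simp
    qed
    then obtain k where k: "\<And>s. s \<in> W \<Longrightarrow> \<sigma> (\<alpha> s) - \<sigma> (\<beta> s) = k"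
      using has_field_derivative_zero_constant[OF convex_W, of "\<lambda>s. \<sigma> (\<alpha> s) - \<sigma> (\<beta> s)"] by blast
    have "s1 \<in> W"
      using s1_I e by (simp add: W_def)
    with k[of s1] s1_I have "k = 0" by simp
    have "s \<in> T" if "s \<in> W" for s
    proof -
      have "\<sigma> (\<alpha> s) = \<sigma> (\<beta> s)"
        using k[OF that] \<open>k = 0\<close> by simp
      then have "\<alpha> s = \<beta> s"
        using flow_boxD(5)[OF box] W[OF that] integral_curve_mem[OF \<alpha>_W that] integral_curve_mem[OF \<beta>_W that]
        by metis
      then show ?thesis using W[OF that] by (simp add: T_def)
    qed
    then show "\<exists>e>0. ball s1 e \<inter> I \<subseteq> T"
      using e(1) by (auto simp: W_def)
  qed
  moreover have "connected I"
    using I by (simp add: is_interval_connected_1)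
  ultimately have "T = {} \<or> T = I"
    by (auto simp: connected_clopen)
  moreover have "u \<in> T" using u by (simp add: T_def)
  ultimately show ?thesis using s by (auto simp: T_def)
qed

text \<open>Only the point at \<open>s0\<close> has to lie in \<open>U\<close>. From there
  uniqueness keeps the curve on the time-shifted \<open>c\<close>, even outside \<open>U\<close>,
  while the extrapolated clock stays within \<open>\<delta>\<close>.\<close>

lemma follow_flow_box:
  assumes \<alpha>: "integral_curve M v \<alpha> I" and I: "is_interval I" and box: "flow_box M v U \<sigma> c \<delta>"
    and s0: "s0 \<in> I" "\<alpha> s0 \<in> U" and s: "s \<in> I" "\<bar>\<sigma> (\<alpha> s0) + s - s0\<bar> < \<delta>"
  shows "\<alpha> s = c (\<sigma> (\<alpha> s0) + s - s0)"
proof -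
  define r where "r = \<sigma> (\<alpha> s0) - s0"
  let ?I = "I \<inter> {s. s + r \<in> {-\<delta><..<\<delta>}}"
  have r: "\<bar>\<sigma> (\<alpha> s0)\<bar> < \<delta> / 2" "c (\<sigma> (\<alpha> s0)) = \<alpha> s0"
    using flow_boxD(4,5)[OF box] integral_curve_mem[OF \<alpha> s0(1)] s0(2) by auto
  have "\<alpha> s = c (s + r)"
  proof (rule integral_curve_unique[where \<alpha> = \<alpha> and \<beta> = "\<lambda>s. c (s + r)" and I = ?I and u = s0])
    show "integral_curve M v \<alpha> ?I"
      using \<alpha> by (rule integral_curve_subset) auto
    show "integral_curve M v (\<lambda>s. c (s + r)) ?I"
      using integral_curve_shift[OF flow_boxD(3)[OF box], of r] by (rule integral_curve_subset) auto
    have "{s. s + r \<in> {-\<delta><..<\<delta>}} = {-\<delta> - r<..<\<delta> - r}"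
      by auto
    then have "is_interval {s. s + r \<in> {-\<delta><..<\<delta>}}"
      by (metis is_interval_oo)
    then show "is_interval ?I"
      using I by (rule is_interval_Int[rotated])
    show "s0 \<in> ?I" "\<alpha> s0 = c (s0 + r)" "s \<in> ?I"
      using s0 r s flow_boxD(2)[OF box] by (auto simp: r_def abs_less_iff algebra_simps)
  qed
  then show ?thesis by (simp add: r_def algebra_simps)
qed

text \<open>The curve \<open>c\<close> is appended from the clock reading at \<open>b\<close>
  onwards; it has the time \<open>\<delta> - \<sigma> (\<alpha> b)\<close> left, which exceeds
  \<open>\<delta> / 2\<close>.\<close>

lemma extend_integral_curve:
  assumes \<alpha>: "integral_curve M v \<alpha> {0..b}" and b: "0 \<le> b"
    and box: "flow_box M v U \<sigma> c \<delta>" "\<alpha> b \<in> U" and b': "b \<le> b'" "b' < b + \<delta> - \<sigma> (\<alpha> b)"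
  obtains \<beta> where "integral_curve M v \<beta> {0..b'}" "\<And>s. s \<in> {0..b} \<Longrightarrow> \<beta> s = \<alpha> s"
proof -
  define r where "r = \<sigma> (\<alpha> b) - b"
  have r: "\<bar>\<sigma> (\<alpha> b)\<bar> < \<delta> / 2" "c (\<sigma> (\<alpha> b)) = \<alpha> b"
    using flow_boxD(4,5)[OF box(1)] integral_curve_mem[OF \<alpha>, of b] b box(2) by auto
  define \<beta> where "\<beta> = (\<lambda>s. if s \<in> {0..b} then \<alpha> s else c (s + r))"
  have c: "integral_curve M v (\<lambda>s. c (s + r)) {b..b'}"
    using integral_curve_shift[OF flow_boxD(3)[OF box(1)], of r]
    by (rule integral_curve_subset) (use b' r in \<open>auto simp: r_def\<close>)
  show thesis
  proof (rule that)
    show "\<beta> s = \<alpha> s" if "s \<in> {0..b}" for s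
      using that by (simp add: \<beta>_def)
    show "integral_curve M v \<beta> {0..b'}"
      unfolding integral_curve_def
    proof (intro ballI conjI)
      fix s assume s: "s \<in> {0..b'}"
      then show "\<beta> s \<in> M"
        using integral_curve_mem[OF \<alpha>, of s] integral_curve_mem[OF c, of s] by (auto simp: \<beta>_def)
      have Un: "{0..b'} = {0..b} \<union> {b..b'}"
        using b b' by auto
      have Int: "closure {0..b} \<inter> closure {b..b'} = {b}"
        using b b' by auto
      have "(\<beta> has_vector_derivative (if s \<in> {0..b} then v (\<alpha> s) else v (c (s + r)))) (at s within {0..b'})"
        unfolding \<beta>_def
      \<comment> \<open>The two pieces meet only at \<open>b\<close>, where their values agree and
        hence, being prescribed by \<open>v\<close>, their velocities as well.\<close>
      proof (rule has_vector_derivative_If_within_closures[OF _ Un, where f' = "\<lambda>s. v (\<alpha> s)" and g' = "\<lambda>s. v (c (s + r))"])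
        show "s \<in> {0..b} \<union> {b..b'}"
          using s Un by blast
        have "{0..b} \<union> {b} = {0..b}" "{b..b'} \<union> {b} = {b..b'}"
          using b b' by auto
        then show "(\<alpha> has_vector_derivative v (\<alpha> s)) (at s within {0..b} \<union> (closure {0..b} \<inter> closure {b..b'}))"
          if "s \<in> {0..b} \<union> (closure {0..b} \<inter> closure {b..b'})"
          using that integral_curve_derivative[OF \<alpha>] unfolding Int by metis
        show "((\<lambda>s. c (s + r)) has_vector_derivative v (c (s + r))) (at s within {b..b'} \<union> (closure {0..b} \<inter> closure {b..b'}))"
          if "s \<in> {b..b'} \<union> (closure {0..b} \<inter> closure {b..b'})"
          using that integral_curve_derivative[OF c] \<open>{b..b'} \<union> {b} = {b..b'}\<close> unfolding Int by metis
        assume "s \<in> closure {0..b}" "s \<in> closure {b..b'}"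
        then have "s = b" using Int by auto
        then show "\<alpha> s = c (s + r)" "v (\<alpha> s) = v (c (s + r))"
          using r by (simp_all add: r_def)
      qed
      then show "(\<beta> has_vector_derivative v (\<beta> s)) (at s within {0..b'})"
        by (simp add: \<beta>_def if_distrib[of v])
    qed
  qed
qed

text \<open>Uniqueness lets all curves on intervals \<open>{0..b}\<close> be merged. The escape
  clause rests on injectivity: a curve that never returns to \<open>p0\<close> cannot repeat any
  point, thus it passes each flow box at most once, and finitely many boxes cover
  \<open>K\<close>.\<close>

theorem maximal_integral_curve:
  assumes p0: "p0 \<in> M"
  obtains J \<gamma> where "0 \<in> J" "J \<subseteq> {0..}" "is_interval J" "integral_curve M v \<gamma> J" "\<gamma> 0 = p0"
    "\<And>s. s \<in> J \<Longrightarrow> \<exists>s'\<in>J. s < s'"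
    "\<And>K. \<lbrakk>compact K; K \<subseteq> M; \<forall>s\<in>J. 0 < s \<longrightarrow> \<gamma> s \<noteq> p0\<rbrakk>
       \<Longrightarrow> \<exists>b\<in>J. \<forall>s\<in>J. b < s \<longrightarrow> \<gamma> s \<notin> K"
proof -
  define P where "P = (\<lambda>\<alpha> b. integral_curve M v \<alpha> {0..b} \<and> \<alpha> 0 = p0)"
  define J where "J = {b. 0 \<le> b \<and> (\<exists>\<alpha>. P \<alpha> b)}"
  \<comment> \<open>For each \<open>s\<close> some integral curve on \<open>{0..s}\<close> is chosen
    anew; uniqueness makes the choices consistent.\<close>
  define \<gamma> where "\<gamma> = (\<lambda>s. (SOME \<alpha>. P \<alpha> s) s)"
  have J_nonneg: "J \<subseteq> {0..}"
    by (auto simp: J_def)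
  have J_down: "s \<in> J" if "b \<in> J" "0 \<le> s" "s \<le> b" for s b
    using that integral_curve_subset[of M v _ "{0..b}" "{0..s}"] by (fastforce simp: J_def P_def)
  have interval_J: "is_interval J"
    unfolding is_interval_1 using J_down J_nonneg by force
  have \<gamma>_eq: "\<gamma> s = \<alpha> s" if "P \<alpha> b" "s \<in> {0..b}" for \<alpha> b s
  proof -
    have "P \<alpha> s"
      using that integral_curve_subset[of M v \<alpha> "{0..b}" "{0..s}"] by (auto simp: P_def)
    define \<beta> where "\<beta> = (SOME \<alpha>. P \<alpha> s)"
    have "P \<beta> s"
      unfolding \<beta>_def using \<open>P \<alpha> s\<close> by (rule someI[of "\<lambda>\<alpha>. P \<alpha> s"])
    have "\<beta> s = \<alpha> s"
      by (rule integral_curve_unique[where \<alpha> = \<beta> and \<beta> = \<alpha> and I = "{0..s}" and u = 0])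
        (use \<open>P \<alpha> s\<close> \<open>P \<beta> s\<close> that in \<open>auto simp: is_interval_cc P_def\<close>)
    then show ?thesis by (simp add: \<gamma>_def \<beta>_def)
  qed
  have \<gamma>_P: "P \<gamma> b" if b: "b \<in> J" for b
  proof -
    from b obtain \<alpha> where \<alpha>: "P \<alpha> b" "0 \<le> b"
      by (auto simp: J_def)
    then show ?thesis
      using \<gamma>_eq[OF \<alpha>(1)] integral_curve_cong[of M v \<alpha> "{0..b}" \<gamma>] by (auto simp: P_def)
  qed
  have extend: "b' \<in> J" if b: "b \<in> J" and box: "flow_box M v U \<sigma> c \<delta>" "\<gamma> b \<in> U"
    and b': "0 \<le> b'" "b' < b + \<delta> - \<sigma> (\<gamma> b)" for b b' U \<sigma> c \<delta>
  proof (cases "b \<le> b'")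
    case True
    have \<gamma>: "0 \<le> b" "integral_curve M v \<gamma> {0..b}" "\<gamma> 0 = p0"
      using b J_nonneg \<gamma>_P[OF b] by (auto simp: P_def)
    obtain \<beta> where "integral_curve M v \<beta> {0..b'}" "\<And>s. s \<in> {0..b} \<Longrightarrow> \<beta> s = \<gamma> s"
      using extend_integral_curve[OF \<gamma>(2,1) box True b'(2)] by blast
    then have "P \<beta> b'"
      using \<gamma> by (simp add: P_def)
    with b' show ?thesis
      by (auto simp: J_def)
  qed (use J_down[OF b] b' in auto)
  have no_max: "\<exists>s'\<in>J. s < s'" if s: "s \<in> J" for s
  proof -
    have s_nonneg: "0 \<le> s" and "\<gamma> s \<in> M"
      using \<gamma>_P[OF s] s J_nonneg by (auto simp: P_def integral_curve_def)
    then obtain U \<sigma> c \<delta> where box: "\<gamma> s \<in> U" "flow_box M v U \<sigma> c \<delta>"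
      using flow_box_at by metis
    have "\<bar>\<sigma> (\<gamma> s)\<bar> < \<delta> / 2" "\<delta> > 0"
      using flow_boxD(2,4)[OF box(2)] box \<open>\<gamma> s \<in> M\<close> by auto
    then have "s + \<delta> / 2 \<in> J"
      using s_nonneg by (intro extend[OF s box(2,1)]) auto
    with \<open>\<delta> > 0\<close> show ?thesis
      by (intro bexI[of _ "s + \<delta> / 2"]) auto
  qed
  have "0 \<in> J" "\<gamma> 0 = p0"
  proof -
    obtain U \<sigma> c \<delta> where box: "p0 \<in> U" "flow_box M v U \<sigma> c \<delta>"
      using flow_box_at[OF p0] by metis
    have "\<bar>\<sigma> p0\<bar> < \<delta> / 2" "c (\<sigma> p0) = p0"
      using flow_boxD(4,5)[OF box(2)] box p0 by auto
    then have "P (\<lambda>s. c (s + \<sigma> p0)) 0"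
      unfolding P_def using flow_boxD(2)[OF box(2)]
      by (intro conjI integral_curve_subset[OF integral_curve_shift[OF flow_boxD(3)[OF box(2)], of "\<sigma> p0"]]) auto
    then show "0 \<in> J"
      by (auto simp: J_def)
    then show "\<gamma> 0 = p0"
      using \<gamma>_P by (auto simp: P_def)
  qed
  have curve: "integral_curve M v \<gamma> J"
    unfolding integral_curve_def
  proof (intro ballI conjI)
    fix s assume s: "s \<in> J"
    then obtain s' where s': "s' \<in> J" "s < s'"
      using no_max by blast
    have "0 \<le> s" using s J_nonneg by auto
    have \<gamma>: "integral_curve M v \<gamma> {0..s'}"
      using \<gamma>_P[OF s'(1)] by (simp add: P_def)
    then show "\<gamma> s \<in> M"
      using s' \<open>0 \<le> s\<close> by (simp add: integral_curve_def)
    have "(\<gamma> has_vector_derivative v (\<gamma> s)) (at s within {0..s'})"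
      using \<gamma> s' \<open>0 \<le> s\<close> by (simp add: integral_curve_def)
    then have "(\<gamma> has_vector_derivative v (\<gamma> s)) (at s within J \<inter> {..<s'})"
      by (rule has_vector_derivative_within_subset) (use J_nonneg in auto)
    \<comment> \<open>Since \<open>s < s'\<close>, cutting \<open>J\<close> off at \<open>s'\<close>
      does not change the filter at \<open>s\<close>; this transfers the derivative from
      \<open>{0..s'}\<close> to \<open>J\<close>.\<close>
    moreover have "at s within J = at s within J \<inter> {..<s'}"
      using s' by (intro at_within_nhd[of s "{..<s'}"]) auto
    ultimately show "(\<gamma> has_vector_derivative v (\<gamma> s)) (at s within J)"
      by simp
  qed
  have local_escape: "\<exists>U. open U \<and> p \<in> U \<and> (\<exists>b\<in>J. \<forall>s\<in>J. b < s \<longrightarrow> \<gamma> s \<notin> U)"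
    if p: "p \<in> M" and no_return: "\<And>s. s \<in> J \<Longrightarrow> 0 < s \<Longrightarrow> \<gamma> s \<noteq> p0" for p
  proof -
    obtain U \<sigma> c \<delta> where box: "p \<in> U" "flow_box M v U \<sigma> c \<delta>"
      using flow_box_at[OF p] by metis
    \<comment> \<open>A repeated point can be shifted back to the start: by uniqueness the curve and
      its translate by \<open>s2 - s1\<close> agree down to the parameter \<open>0\<close>, a return
      to \<open>p0\<close>.\<close>
    have inj: False if "s1 \<in> J" "s2 \<in> J" "s1 < s2" "\<gamma> s1 = \<gamma> s2" for s1 s2
    proof -
      define r where "r = s2 - s1"
      have "0 \<le> s1" using that J_nonneg by auto
      have "integral_curve M v \<gamma> {0..s1}"
        using curve by (rule integral_curve_subset) (use that J_down[OF that(1)] in auto)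
      moreover have "integral_curve M v (\<lambda>s. \<gamma> (s + r)) {0..s1}"
        using integral_curve_shift[OF curve, of r]
        by (rule integral_curve_subset) (use that J_down[OF that(2)] in \<open>auto simp: r_def\<close>)
      ultimately have "\<gamma> 0 = \<gamma> (0 + r)"
        by (rule integral_curve_unique[where \<alpha> = \<gamma> and \<beta> = "\<lambda>s. \<gamma> (s + r)" and I = "{0..s1}" and u = s1])
          (use that \<open>0 \<le> s1\<close> in \<open>auto simp: r_def is_interval_cc\<close>)
      moreover have "r \<in> J" "0 < r"
        using that J_down[OF that(2), of r] \<open>0 \<le> s1\<close> by (auto simp: r_def)
      ultimately show False
        using no_return[of r] \<open>\<gamma> 0 = p0\<close> by simp
    qed
    have "\<exists>b\<in>J. \<forall>s\<in>J. b < s \<longrightarrow> \<gamma> s \<notin> U"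
    proof (cases "\<exists>s\<in>J. \<gamma> s \<in> U")
      case True
      then obtain s0 where s0: "s0 \<in> J" "\<gamma> s0 \<in> U" by blast
      define r0 where "r0 = \<sigma> (\<gamma> s0)"
      have r0: "\<bar>r0\<bar> < \<delta> / 2"
        unfolding r0_def using flow_boxD(4)[OF box(2)] s0 integral_curve_mem[OF curve] by blast
      have "0 < \<delta>" "0 \<le> s0"
        using flow_boxD(2)[OF box(2)] s0 J_nonneg by auto
      \<comment> \<open>At this parameter the clock started at \<open>s0\<close> would read
        \<open>\<delta> / 2\<close>, beyond all readings in \<open>U\<close>.\<close>
      define b where "b = s0 + \<delta> / 2 - r0"
      have "b \<in> J"
        using r0 \<open>0 < \<delta>\<close> \<open>0 \<le> s0\<close> by (intro extend[OF s0(1) box(2) s0(2)]) (auto simp: b_def r0_def)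
      moreover have "\<gamma> s \<notin> U" if s: "s \<in> J" "b < s" for s
      proof
        assume U: "\<gamma> s \<in> U"
        define r where "r = \<sigma> (\<gamma> s)"
        have r: "\<bar>r\<bar> < \<delta> / 2"
          unfolding r_def using flow_boxD(4)[OF box(2)] s U integral_curve_mem[OF curve] by blast
        \<comment> \<open>The parameter at which the clock read at \<open>s\<close> would show
          \<open>r0\<close> again, so that \<open>\<gamma> s'\<close> and \<open>\<gamma> s0\<close>
          are the same point of \<open>c\<close>. It may exceed \<open>s\<close>, but
          \<open>extend\<close> keeps it in \<open>J\<close>.\<close>
        define s' where "s' = s + r0 - r"
        have s': "s0 < s'"
          using s r by (auto simp: s'_def b_def)
        have "s' \<in> J"
          using r0 s' \<open>0 \<le> s0\<close> \<open>0 < \<delta>\<close> by (intro extend[OF s(1) box(2) U]) (auto simp: s'_def r_def)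
        have "\<gamma> s' = c (r + s' - s)" "\<gamma> s0 = c (r0 + s0 - s0)"
          unfolding r_def r0_def
          by (rule follow_flow_box[OF curve interval_J box(2)];
              use s U \<open>s' \<in> J\<close> s0 r0 \<open>0 < \<delta>\<close> in \<open>simp add: s'_def r_def r0_def\<close>)+
        then have "\<gamma> s0 = \<gamma> s'"
          by (simp add: s'_def)
        then show False
          using inj s' \<open>s' \<in> J\<close> s0 by blast
      qed
      ultimately show ?thesis by blast
    qed (use \<open>0 \<in> J\<close> in blast)
    then show ?thesis
      using flow_boxD(1)[OF box(2)] box(1) by blast
  qed
  have escape: "\<exists>b\<in>J. \<forall>s\<in>J. b < s \<longrightarrow> \<gamma> s \<notin> K"
    if K: "compact K" "K \<subseteq> M" and no_return: "\<forall>s\<in>J. 0 < s \<longrightarrow> \<gamma> s \<noteq> p0" for K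
  proof -
    define C where "C = {U. open U \<and> (\<exists>b\<in>J. \<forall>s\<in>J. b < s \<longrightarrow> \<gamma> s \<notin> U)}"
    have "K \<subseteq> \<Union>C"
    proof
      fix p assume "p \<in> K"
      then show "p \<in> \<Union>C"
        using local_escape[of p] K(2) no_return unfolding C_def by blast
    qed
    then obtain D where D: "D \<subseteq> C" "finite D" "K \<subseteq> \<Union>D"
      using compactE[OF K(1), of C] C_def by blast
    then have "\<forall>U\<in>D. \<exists>b. b \<in> J \<and> (\<forall>s\<in>J. b < s \<longrightarrow> \<gamma> s \<notin> U)"
      by (auto simp: C_def)
    then obtain b where b: "\<And>U. U \<in> D \<Longrightarrow> b U \<in> J" "\<And>U s. U \<in> D \<Longrightarrow> s \<in> J \<Longrightarrow> b U < s \<Longrightarrow> \<gamma> s \<notin> U"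
      by metis
    \<comment> \<open>Inserting \<open>0\<close> covers an empty \<open>D\<close>.\<close>
    define B where "B = Max (insert 0 (b ` D))"
    have "B \<in> insert 0 (b ` D)"
      unfolding B_def using D(2) by (intro Max_in) auto
    then have "B \<in> J"
      using \<open>0 \<in> J\<close> b(1) by auto
    moreover have "\<gamma> s \<notin> K" if "s \<in> J" "B < s" for s
    proof
      assume "\<gamma> s \<in> K"
      then obtain U where U: "U \<in> D" "\<gamma> s \<in> U" using D(3) by blast
      then have "b U \<le> B"
        unfolding B_def using D(2) by (intro Max_ge) auto
      with b(2)[OF U(1) that(1)] U(2) that(2) show False by simp
    qed
    ultimately show ?thesis by blast
  qed
  show thesis
    by (rule that[OF \<open>0 \<in> J\<close> J_nonneg interval_J curve \<open>\<gamma> 0 = p0\<close> no_max escape])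
qed

end

section \<open>A continuously differentiable extension of the homotopy\<close>

lemma continuously_differentiableI:
  fixes g :: "'a::euclidean_space \<Rightarrow> 'b::real_normed_vector"
  assumes "\<And>p. (g has_derivative D p) (at p)"
    and "\<And>i. i \<in> Basis \<Longrightarrow> continuous_on UNIV (\<lambda>p. D p i)"
  shows "continuously_differentiable g"
proof -
  have "blinfun_apply (Blinfun (D p)) = D p" for p
    using assms(1) by (intro bounded_linear_Blinfun_apply has_derivative_bounded_linear)
  then show ?thesis
    unfolding continuously_differentiable_def using assms
    by (intro exI[of _ "\<lambda>p. Blinfun (D p)"]) (auto intro!: continuous_on_blinfun_componentwise)
qed

lemma continuously_differentiableE:
  assumes "continuously_differentiable g"
  obtains g' where "\<And>x. (g has_derivative blinfun_apply (g' x)) (at x)" "continuous_on UNIV g'"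
    "continuous_on UNIV g"
proof -
  from assms obtain g' where g': "\<forall>x. (g has_derivative blinfun_apply (g' x)) (at x)" "continuous_on UNIV g'"
    by (auto simp: continuously_differentiable_def)
  moreover have "continuous_on UNIV g"
    using g'(1) by (intro continuous_at_imp_continuous_on) (auto intro: has_derivative_continuous)
  ultimately show thesis using that by blast
qed

lemma continuously_differentiable_bounded_linear:
  "bounded_linear (l :: 'a::euclidean_space \<Rightarrow> 'b::real_normed_vector) \<Longrightarrow> continuously_differentiable l"
  by (rule continuously_differentiableI[where D = "\<lambda>_. l"])
    (auto intro: bounded_linear_imp_has_derivative)

lemma continuously_differentiable_const:
  "continuously_differentiable (\<lambda>_ :: 'a::euclidean_space. c :: 'b::real_normed_vector)"
  by (rule continuously_differentiableI[where D = "\<lambda>_ _. 0"]) auto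

lemma continuously_differentiable_add:
  fixes g k :: "'a::euclidean_space \<Rightarrow> 'b::real_normed_vector"
  assumes "continuously_differentiable g" "continuously_differentiable k"
  shows "continuously_differentiable (\<lambda>p. g p + k p)"
proof -
  obtain g' where g: "\<And>x. (g has_derivative blinfun_apply (g' x)) (at x)" "continuous_on UNIV g'"
    by (rule continuously_differentiableE[OF assms(1)]) (rule that)
  obtain k' where k: "\<And>x. (k has_derivative blinfun_apply (k' x)) (at x)" "continuous_on UNIV k'"
    by (rule continuously_differentiableE[OF assms(2)]) (rule that)
  show ?thesis
    by (rule continuously_differentiableI[where D = "\<lambda>p u. g' p u + k' p u"])
      (auto intro!: continuous_intros derivative_intros g k)
qed

lemma continuously_differentiable_scaleR:
  fixes a :: "'a::euclidean_space \<Rightarrow> real" and g :: "'a \<Rightarrow> 'b::real_normed_vector"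
  assumes "continuously_differentiable a" "continuously_differentiable g"
  shows "continuously_differentiable (\<lambda>p. a p *\<^sub>R g p)"
proof -
  obtain a' where a: "\<And>x. (a has_derivative blinfun_apply (a' x)) (at x)" "continuous_on UNIV a'"
    and a_cont: "continuous_on UNIV a"
    by (rule continuously_differentiableE[OF assms(1)]) (rule that)
  obtain g' where g: "\<And>x. (g has_derivative blinfun_apply (g' x)) (at x)" "continuous_on UNIV g'"
    and g_cont: "continuous_on UNIV g"
    by (rule continuously_differentiableE[OF assms(2)]) (rule that)
  show ?thesis
    by (rule continuously_differentiableI[where D = "\<lambda>p u. a p *\<^sub>R g' p u + a' p u *\<^sub>R g p"])
      (auto intro!: continuous_intros has_derivative_scaleR a a_cont g g_cont)
qed

lemma continuously_differentiable_sum: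
  fixes g :: "'i \<Rightarrow> 'a::euclidean_space \<Rightarrow> 'b::real_normed_vector"
  assumes "\<And>i. i \<in> I \<Longrightarrow> continuously_differentiable (g i)"
  shows "continuously_differentiable (\<lambda>p. \<Sum>i\<in>I. g i p)"
  using assms
  by (induction I rule: infinite_finite_induct)
    (auto intro: continuously_differentiable_add continuously_differentiable_const)

lemma continuously_differentiable_compose:
  fixes g :: "'b::euclidean_space \<Rightarrow> 'c::real_normed_vector" and k :: "'a::euclidean_space \<Rightarrow> 'b"
  assumes "continuously_differentiable g" "continuously_differentiable k"
  shows "continuously_differentiable (\<lambda>p. g (k p))"
proof -
  obtain g' where g: "\<And>x. (g has_derivative blinfun_apply (g' x)) (at x)" "continuous_on UNIV g'"
    by (rule continuously_differentiableE[OF assms(1)]) (rule that)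
  obtain k' where k: "\<And>x. (k has_derivative blinfun_apply (k' x)) (at x)" "continuous_on UNIV k'"
    and k_cont: "continuous_on UNIV k"
    by (rule continuously_differentiableE[OF assms(2)]) (rule that)
  show ?thesis
    by (rule continuously_differentiableI[where D = "\<lambda>p u. g' (k p) (k' p u)"])
      (auto intro!: continuous_intros has_derivative_compose[OF k(1) g(1)] k
        continuous_on_compose2[OF g(2) k_cont])
qed

lemma continuously_differentiable_real:
  fixes g :: "real \<Rightarrow> real"
  assumes "\<And>t. (g has_real_derivative g' t) (at t)" "continuous_on UNIV g'"
  shows "continuously_differentiable g"
  by (rule continuously_differentiableI[where D = "\<lambda>t u. g' t * u"])
    (use assms in \<open>auto simp: has_field_derivative_def intro!: continuous_intros\<close>)

section \<open>The switching function with clamped argument\<close>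

definition smoothstep :: "real \<Rightarrow> real" where
  "smoothstep y = (sin (max 0 (min 1 y) * (pi / 2)))\<^sup>2"

lemma smoothstep_low: "y \<le> 0 \<Longrightarrow> smoothstep y = 0"
  by (simp add: smoothstep_def)

lemma smoothstep_high: "1 \<le> y \<Longrightarrow> smoothstep y = 1"
  by (simp add: smoothstep_def)

lemma has_real_derivative_split:
  fixes g :: "real \<Rightarrow> real"
  assumes "(g has_real_derivative D) (at x within {..x})" "(g has_real_derivative D) (at x within {x..})"
  shows "(g has_real_derivative D) (at x)"
proof -
  have "{..x} \<union> {x..} = (UNIV :: real set)" by auto
  then show ?thesis
    using assms Lim_Un[of _ D x "{..x}" "{x..}"] by (simp add: has_field_derivative_iff)
qed

text \<open>On the unit interval the double angle formula gives a multiple of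
  \<open>sin (pi * y)\<close>, which vanishes at \<open>0\<close> and \<open>1\<close>. The
  one-sided derivatives there match those of the constant parts, and clamping the argument covers
  all cases in one formula.\<close>

lemma smoothstep_deriv:
  "(smoothstep has_real_derivative (pi / 2) * sin (pi * max 0 (min 1 y))) (at y)"
proof -
  define s where "s = (\<lambda>y. (sin (y * (pi / 2)))\<^sup>2)"
  have s': "(s has_real_derivative (pi / 2) * sin (pi * y)) (at y within S)" for y S
  proof -
    have "sin (pi * y) = 2 * sin (y * (pi / 2)) * cos (y * (pi / 2))"
      using sin_double[of "y * (pi / 2)"] by (simp add: mult.commute)
    then show ?thesis
      unfolding s_def by (auto intro!: derivative_eq_intros)
  qed
  have low: "(smoothstep has_real_derivative 0) (at y within {..y})" if "y \<le> 0" for y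
    by (rule has_field_derivative_transform_within[where f = "\<lambda>_. 0" and d = 1]) (use that in \<open>auto simp: smoothstep_low\<close>)
  have high: "(smoothstep has_real_derivative 0) (at y within {y..})" if "1 \<le> y" for y
    by (rule has_field_derivative_transform_within[where f = "\<lambda>_. 1" and d = 1]) (use that in \<open>auto simp: smoothstep_high\<close>)
  have mid: "(smoothstep has_real_derivative (pi / 2) * sin (pi * y)) (at y within S)" if "y \<in> S" "S \<subseteq> {0..1}" for y S
    by (rule has_field_derivative_transform_within[OF s', where d = 1])
      (use that in \<open>auto simp: smoothstep_def s_def subset_iff\<close>)
  consider "y < 0" | "y = 0" | "0 < y" "y < 1" | "y = 1" | "1 < y" by linarith
  then show ?thesis
  proof cases
    case 1
    then have "(smoothstep has_real_derivative 0) (at y)"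
      by (intro DERIV_cong_ev[THEN iffD2, OF refl _ refl DERIV_const[of 0]]
          eventually_mono[OF eventually_nhds_in_open[of "{..<0}"]]) (auto simp: smoothstep_low)
    with 1 show ?thesis by simp
  next
    case 2
    have "(smoothstep has_real_derivative 0) (at 0 within {0..1})"
      using mid[of 0 "{0..1}"] by simp
    moreover have "at (0::real) within {0..1} = at 0 within {0..}"
      by (rule at_within_nhd[of _ "{..<1}"]) auto
    ultimately show ?thesis
      using low[of 0] 2 by (intro has_real_derivative_split) auto
  next
    case 3
    then show ?thesis
      using mid[of y "{0<..<1}"] by (simp add: at_within_open[of y "{0<..<1}"] subset_iff)
  next
    case 4
    have "(smoothstep has_real_derivative 0) (at 1 within {0..1})"
      using mid[of 1 "{0..1}"] by simp
    moreover have "at (1::real) within {0..1} = at 1 within {..1}"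
      by (rule at_within_nhd[of _ "{0<..}"]) auto
    ultimately show ?thesis
      using high[of 1] 4 by (intro has_real_derivative_split) auto
  next
    case 5
    then have "(smoothstep has_real_derivative 0) (at y)"
      by (intro DERIV_cong_ev[THEN iffD2, OF refl _ refl DERIV_const[of 1]]
          eventually_mono[OF eventually_nhds_in_open[of "{1<..}"]]) (auto simp: smoothstep_high)
    with 5 show ?thesis by simp
  qed
qed

lemma continuously_differentiable_smoothstep: "continuously_differentiable smoothstep"
  by (rule continuously_differentiable_real[OF smoothstep_deriv]) (intro continuous_intros)

text \<open>Replacing each \<open>theta\<close> by its continuation with the constant values \<open>0\<close> and \<open>1\<close> turns
  the piecewise definition of the homotopy into one telescoping formula that is continuously
  differentiable for all real \<open>t\<close>.\<close>

definition extended_homotopy ::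
    "(real^'n \<Rightarrow> 'w \<Rightarrow> real^'n) \<Rightarrow> (nat \<Rightarrow> 'w) \<Rightarrow> (nat \<Rightarrow> nat) \<Rightarrow> (nat \<Rightarrow> real) \<Rightarrow> nat
      \<Rightarrow> real^'n \<Rightarrow> (real^'n) \<times> real \<Rightarrow> real^'n" where
  "extended_homotopy f \<xi> q \<tau> L x0 p =
     (1 - snd p) *\<^sub>R (\<Sum>l=1..L. smoothstep ((snd p - \<tau> (l - 1)) / (\<tau> l - \<tau> (l - 1))) *\<^sub>R
        (level_map f \<xi> q l (fst p) - level_map f \<xi> q (l - 1) (fst p))) + snd p *\<^sub>R (fst p - x0)"

lemma continuously_differentiable_level_map:
  assumes "\<And>i. l \<noteq> 0 \<Longrightarrow> i \<in> {1..q l} \<Longrightarrow> continuously_differentiable (\<lambda>x. f x (\<xi> i))"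
  shows "continuously_differentiable (level_map f \<xi> q l)"
proof (cases "l = 0")
  case True
  then show ?thesis
    using continuously_differentiable_const[of "0 :: real^'a"] by (simp add: level_map_def[abs_def])
next
  case False
  then have "continuously_differentiable (\<lambda>x. (1 / real (q l)) *\<^sub>R (\<Sum>i=1..q l. f x (\<xi> i)))"
    by (intro continuously_differentiable_scaleR continuously_differentiable_const
        continuously_differentiable_sum assms)
  with False show ?thesis
    by (simp add: level_map_def[abs_def] sample_avg_def[abs_def])
qed

lemma continuously_differentiable_extended_homotopy:
  fixes f :: "real^'n \<Rightarrow> 'w \<Rightarrow> real^'n"
  assumes "\<And>l i. l \<in> {1..L} \<Longrightarrow> i \<in> {1..q l} \<Longrightarrow> continuously_differentiable (\<lambda>x. f x (\<xi> i))"
  shows "continuously_differentiable (extended_homotopy f \<xi> q \<tau> L x0)"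
proof -
  have fst: "continuously_differentiable (fst :: (real^'n) \<times> real \<Rightarrow> _)"
    and snd: "continuously_differentiable (snd :: (real^'n) \<times> real \<Rightarrow> _)"
    by (intro continuously_differentiable_bounded_linear bounded_linear_fst bounded_linear_snd)+
  have diff: "continuously_differentiable (\<lambda>p. g p - k p)"
    if "continuously_differentiable g" "continuously_differentiable k"
    for g k :: "(real^'n) \<times> real \<Rightarrow> 'z::real_normed_vector"
    using continuously_differentiable_add[OF that(1) continuously_differentiable_scaleR[OF
      continuously_differentiable_const[of "-1"] that(2)]] by simp
  have level: "continuously_differentiable (\<lambda>p :: (real^'n) \<times> real. level_map f \<xi> q l (fst p))" if "l \<le> L" for l
    by (intro continuously_differentiable_compose[OF _ fst] continuously_differentiable_level_map assms[of l])
      (use that in auto)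
  have arg: "continuously_differentiable (\<lambda>p :: (real^'n) \<times> real. (snd p - a) / b)" for a b
    using continuously_differentiable_scaleR[OF continuously_differentiable_const[of "1 / b"]
      diff[OF snd continuously_differentiable_const[of a]]] by simp
  show ?thesis
    unfolding extended_homotopy_def[abs_def]
    by (intro continuously_differentiable_add continuously_differentiable_scaleR continuously_differentiable_sum
        diff fst snd continuously_differentiable_const level
        continuously_differentiable_compose[OF continuously_differentiable_smoothstep arg]) auto
qed

text \<open>From \<open>\<tau> 0\<close> upwards no switch has started yet, so the sum
  vanishes.\<close>

lemma extended_homotopy_above:
  assumes dec: "\<And>l. l < L \<Longrightarrow> \<tau> (Suc l) < \<tau> l" and t: "\<tau> 0 \<le> t"
  shows "extended_homotopy f \<xi> q \<tau> L x0 (x, t) = t *\<^sub>R (x - x0)"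
proof -
  have le: "\<tau> l \<le> \<tau> 0" if "l \<le> L" for l
    using that
  proof (induction l)
    case (Suc l)
    then show ?case using dec[of l] by simp
  qed simp
  have "smoothstep ((t - \<tau> (l - 1)) / (\<tau> l - \<tau> (l - 1))) = 0" if "l \<in> {1..L}" for l
  proof (rule smoothstep_low)
    have "\<tau> l < \<tau> (l - 1)" "\<tau> (l - 1) \<le> t"
      using dec[of "l - 1"] order_trans[OF le t, of "l - 1"] that by auto
    then show "(t - \<tau> (l - 1)) / (\<tau> l - \<tau> (l - 1)) \<le> 0"
      by (simp add: divide_nonneg_neg)
  qed
  then show ?thesis
    by (simp add: extended_homotopy_def)
qed

lemma exists_level:
  assumes dec: "\<And>l. l < L \<Longrightarrow> \<tau> (Suc l) < (\<tau> l :: real)" and L: "1 \<le> L"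
    and t: "\<tau> L \<le> t" "t \<le> \<tau> 0"
  obtains l where "l \<in> {1..L}" "t \<in> {\<tau> l..\<tau> (l - 1)}"
proof -
  define P where "P = (\<lambda>l. l \<ge> 1 \<and> \<tau> l \<le> t)"
  define l where "l = (LEAST l. P l)"
  have "P L"
    using L t by (simp add: P_def)
  then have "P l" "l \<le> L"
    unfolding l_def by (rule LeastI, rule Least_le)
  then have l: "l \<ge> 1" "\<tau> l \<le> t"
    by (auto simp: P_def)
  have "t \<le> \<tau> (l - 1)"
  proof (cases "l = 1")
    case False
    have "\<not> P (l - 1)"
      by (rule not_less_Least) (use l in \<open>simp add: l_def[symmetric]\<close>)
    then show ?thesis
      using False l by (auto simp: P_def)
  qed (use t in simp)
  with \<open>l \<le> L\<close> l show thesis using that by auto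
qed

text \<open>At a level \<open>t\<close> of piece \<open>l\<close>, the switches before
  \<open>l\<close> are complete and those after \<open>l\<close> have not started. The completed
  differences telescope to level \<open>l - 1\<close>, leaving a single active switch.\<close>

lemma extended_homotopy_eq:
  assumes dec: "\<And>l. l < L \<Longrightarrow> \<tau> (Suc l) < \<tau> l" and l: "l \<in> {1..L}" and t: "t \<in> {\<tau> l..\<tau> (l - 1)}"
  shows "extended_homotopy f \<xi> q \<tau> L x0 (x, t) = (1 - t) *\<^sub>R d_piece f \<xi> q \<tau> l x t + t *\<^sub>R (x - x0)"
proof -
  define F where "F = (\<lambda>j. level_map f \<xi> q j x)"
  define \<Theta> where "\<Theta> = (\<lambda>j. smoothstep ((t - \<tau> (j - 1)) / (\<tau> j - \<tau> (j - 1))))"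
  have anti: "\<tau> b \<le> \<tau> a" if "a \<le> b" "b \<le> L" for a b
    using that
  proof (induction b)
    case (Suc b)
    then show ?case using dec[of b] by (cases "a = Suc b") auto
  qed simp
  have step: "\<tau> j < \<tau> (j - 1)" if "j \<in> {1..L}" for j
    using dec[of "j - 1"] that by auto
  have high: "\<Theta> j = 1" if "j \<in> {1..<l}" for j
    unfolding \<Theta>_def
  proof (rule smoothstep_high)
    have "j \<le> l - 1" "l - 1 \<le> L" "j \<in> {1..L}"
      using that l by auto
    then have "t \<le> \<tau> j" "\<tau> j < \<tau> (j - 1)"
      using t anti[of j "l - 1"] step[of j] by auto
    then show "1 \<le> (t - \<tau> (j - 1)) / (\<tau> j - \<tau> (j - 1))"
      by (simp add: le_divide_eq)
  qed
  have low: "\<Theta> j = 0" if "j \<in> {l<..L}" for j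
    unfolding \<Theta>_def
  proof (rule smoothstep_low)
    have "l \<le> j - 1" "j - 1 \<le> L" "j \<in> {1..L}"
      using that l by auto
    then have "\<tau> (j - 1) \<le> t" "\<tau> j < \<tau> (j - 1)"
      using t anti[of l "j - 1"] step[of j] by auto
    then show "(t - \<tau> (j - 1)) / (\<tau> j - \<tau> (j - 1)) \<le> 0"
      by (simp add: divide_nonneg_neg)
  qed
  have "0 \<le> (t - \<tau> (l - 1)) / (\<tau> l - \<tau> (l - 1))" "(t - \<tau> (l - 1)) / (\<tau> l - \<tau> (l - 1)) \<le> 1"
    using t step[OF l] by (auto simp: divide_nonpos_neg divide_le_eq)
  then have mid: "\<Theta> l = theta \<tau> l t"
    by (simp add: \<Theta>_def smoothstep_def theta_def)
  \<comment> \<open>The sum leaves no remainder because \<open>F 0\<close> is zero by the convention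
    for level \<open>0\<close>.\<close>
  have tele: "(\<Sum>j\<in>{1..<Suc m}. F j - F (j - 1)) = F m" for m
    by (induction m) (auto simp: F_def level_map_def)
  obtain m where m: "l = Suc m"
    using l by (cases l) auto
  have tele_l: "(\<Sum>j\<in>{1..<l}. F j - F (j - 1)) = F (l - 1)"
    unfolding m using tele[of m] by (simp only: diff_Suc_1)
  have "{1..L} = {1..<l} \<union> {l} \<union> {l<..L}" "{Suc 0..<l} \<inter> {l<..L} = {}"
    using l by auto
  then have "(\<Sum>j=1..L. \<Theta> j *\<^sub>R (F j - F (j - 1)))
      = (\<Sum>j\<in>{1..<l}. \<Theta> j *\<^sub>R (F j - F (j - 1))) + \<Theta> l *\<^sub>R (F l - F (l - 1)) + (\<Sum>j\<in>{l<..L}. \<Theta> j *\<^sub>R (F j - F (j - 1)))"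
    by (simp add: sum.union_disjoint)
  also have "\<dots> = F (l - 1) + \<Theta> l *\<^sub>R (F l - F (l - 1))"
    using tele_l high low by simp
  also have "\<dots> = d_piece f \<xi> q \<tau> l x t"
    by (simp add: d_piece_def mid F_def algebra_simps)
  finally show ?thesis
    by (simp add: extended_homotopy_def \<Theta>_def F_def)
qed

lemma homotopy_map_eq_extended:
  assumes dec: "\<And>l. l < L \<Longrightarrow> \<tau> (Suc l) < \<tau> l" and L: "1 \<le> L" and t: "\<tau> L \<le> snd p" "snd p \<le> \<tau> 0"
  shows "homotopy_map f \<xi> q \<tau> L x0 p = extended_homotopy f \<xi> q \<tau> L x0 p"
proof -
  obtain l where l: "l \<in> {1..L}" "snd p \<in> {\<tau> l..\<tau> (l - 1)}"
    by (rule exists_level[OF dec L t])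
  have "d_map f \<xi> q \<tau> L (fst p) (snd p) = d_piece f \<xi> q \<tau> l (fst p) (snd p)"
    by (rule d_map_eq[OF dec l])
  then show ?thesis
    using extended_homotopy_eq[OF dec l, of f \<xi> q x0 "fst p"] by (simp add: homotopy_map_def split_beta)
qed

section \<open>Reparametrization and limits of curves\<close>

text \<open>Compactness gives the least parameter with value at most \<open>c\<close>; a value
  strictly below \<open>c\<close> there would force an earlier hit by the intermediate value
  theorem.\<close>

lemma first_hit:
  fixes y :: "real \<Rightarrow> real"
  assumes cont: "continuous_on {a..b} y" and ab: "a \<le> b" and c: "c < y a" "y b \<le> c"
  obtains s where "a < s" "s \<le> b" "y s = c" "\<And>r. a \<le> r \<Longrightarrow> r < s \<Longrightarrow> c < y r"
proof -
  define A where "A = {a..b} \<inter> y -` {..c}"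
  have "closed A"
    unfolding A_def by (rule continuous_closed_preimage[OF cont]) auto
  then have "compact ({a..b} \<inter> A)"
    by (intro compact_Int_closed) auto
  moreover have "b \<in> {a..b} \<inter> A"
    using ab c by (simp add: A_def)
  ultimately obtain s where s: "s \<in> {a..b} \<inter> A" "\<And>r. r \<in> {a..b} \<inter> A \<Longrightarrow> s \<le> r"
    using compact_attains_inf[of "{a..b} \<inter> A"] by blast
  have bounds: "a \<le> s" "s \<le> b" "y s \<le> c"
    using s by (auto simp: A_def)
  have above: "c < y r" if "a \<le> r" "r < s" for r
    using s(2)[of r] that bounds by (force simp: A_def)
  have "continuous_on {a..s} y"
    by (rule continuous_on_subset[OF cont]) (use bounds in auto)
  then obtain r where r: "a \<le> r" "r \<le> s" "y r = c"
    using IVT2'[of y s c a] bounds c by auto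
  then have "r = s"
    using above[of r] by fastforce
  moreover have "a \<noteq> s"
    using r \<open>r = s\<close> c by auto
  ultimately show thesis
    using r bounds above by (intro that[of s]) auto
qed

text \<open>A first return to the level \<open>c\<close> would come from below, whereas a negative
  derivative there puts the preceding values above \<open>c\<close>.\<close>

lemma stays_below_start:
  fixes y :: "real \<Rightarrow> real"
  assumes J: "is_interval J" "0 \<in> J"
    and deriv: "\<And>s. s \<in> J \<Longrightarrow> (y has_real_derivative y' s) (at s within J)"
    and start: "y 0 = c" and crossing: "\<And>s. s \<in> J \<Longrightarrow> y s = c \<Longrightarrow> y' s < 0"
    and s1: "s1 \<in> J" "0 < s1"
  shows "y s1 < c"
proof (rule ccontr)
  assume not_below: "\<not> y s1 < c"
  have in_J: "s \<in> J" if "0 \<le> s" "s \<le> s1" for s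
    using that J s1 unfolding is_interval_1 by blast
  obtain d where d: "0 < d" "\<And>h. \<lbrakk>0 < h; 0 + h \<in> J; h < d\<rbrakk> \<Longrightarrow> y (0 + h) < y 0"
    using has_real_derivative_neg_dec_right[OF deriv[OF J(2)] crossing[OF J(2) start]] by blast
  define a where "a = min (d / 2) s1"
  have a: "0 < a" "a \<le> s1"
    using d s1 by (auto simp: a_def)
  have "a < d"
    using d(1) by (simp add: a_def min_def)
  then have "y a < c"
    using d(2)[of a] a in_J[of a] start by simp
  have "continuous_on J y"
    using deriv by (rule DERIV_continuous_on)
  \<comment> \<open>The sign change turns the first return from below into a first hit from
    above.\<close>
  then have "continuous_on {a..s1} (\<lambda>s. - y s)"
    by (intro continuous_on_minus) (rule continuous_on_subset, use in_J a in auto)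
  then obtain s where s: "a < s" "s \<le> s1" "- y s = - c" "\<And>r. a \<le> r \<Longrightarrow> r < s \<Longrightarrow> - c < - y r"
    by (rule first_hit[where c = "-c"]) (use a \<open>y a < c\<close> not_below in auto)
  have "s \<in> J" "y s = c"
    using s a in_J[of s] by auto
  then obtain e where e: "0 < e" "\<And>h. \<lbrakk>0 < h; s - h \<in> J; h < e\<rbrakk> \<Longrightarrow> y s < y (s - h)"
    using has_real_derivative_neg_dec_left[OF deriv crossing] by blast
  define h where "h = min (e / 2) (s - a)"
  have h: "0 < h" "h \<le> s - a" "h < e"
    using e s by (auto simp: h_def min_def)
  then have "c < y (s - h)"
    using e(2)[of h] in_J[of "s - h"] a s \<open>y s = c\<close> by auto
  with s(4)[of "s - h"] h show False by simp
qed

text \<open>The parameter interval of a maximal curve has no largest element, so it is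
  \<open>{0..<T}\<close> or the whole half-line. Scaling by \<open>T\<close> and
  \<open>r / (1 - r)\<close>, respectively, bring it to \<open>{0..<1}\<close>.\<close>

lemma interval_parametrization:
  assumes J: "is_interval J" "0 \<in> J" "J \<subseteq> {0..}" and no_max: "\<And>s. s \<in> J \<Longrightarrow> \<exists>s'\<in>J. s < (s'::real)"
  obtains \<phi> \<phi>' where "\<phi> 0 = (0::real)" "\<phi> ` {0..<1} \<subseteq> J"
    "\<And>r. r \<in> {0..<1} \<Longrightarrow> (\<phi> has_real_derivative \<phi>' r) (at r within {0..<1})"
    "continuous_on {0..<1} \<phi>'" "\<And>r. r \<in> {0..<1} \<Longrightarrow> \<phi>' r \<noteq> 0"
    "\<And>b. b \<in> J \<Longrightarrow> \<exists>a\<in>{0..<1}. \<forall>r\<in>{a..<1}. b < \<phi> r"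
proof (cases "bdd_above J")
  case True
  define T where "T = Sup J"
  have below: "s < T" if s: "s \<in> J" for s
  proof -
    obtain s' where "s' \<in> J" "s < s'"
      using no_max[OF s] by blast
    then show ?thesis
      using cSup_upper[OF _ True, of s'] by (simp add: T_def)
  qed
  have "0 < T"
    using below J(2) by blast
  have in_J: "s \<in> J" if "0 \<le> s" "s < T" for s
  proof -
    have "J \<noteq> {}"
      using J(2) by blast
    then obtain s' where "s' \<in> J" "s < s'"
      using less_cSup_iff[OF _ True, of s] \<open>s < T\<close> unfolding T_def by blast
    then show ?thesis
      using J that unfolding is_interval_1 by (meson less_imp_le)
  qed
  show thesis
  proof (rule that[of "\<lambda>r. T * r" "\<lambda>_. T"])
    show "(\<lambda>r. T * r) ` {0..<1} \<subseteq> J"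
      using \<open>0 < T\<close> by (auto intro!: in_J)
    show "\<exists>a\<in>{0..<1}. \<forall>r\<in>{a..<1}. b < T * r" if b: "b \<in> J" for b
    proof (intro bexI ballI)
      have b: "0 \<le> b" "b < T"
        using below[OF b] J(3) b by auto
      then show "(b / T + 1) / 2 \<in> {0..<1}"
        using \<open>0 < T\<close> by (auto simp: field_simps)
      fix r assume r: "r \<in> {(b / T + 1) / 2..<1}"
      have "b / T < (b / T + 1) / 2"
        using b \<open>0 < T\<close> by (simp add: field_simps)
      also have "\<dots> \<le> r"
        using r by simp
      finally show "b < T * r"
        using \<open>0 < T\<close> by (simp add: pos_divide_less_eq mult.commute)
    qed
  qed (use \<open>0 < T\<close> in \<open>auto intro!: derivative_eq_intros\<close>)
next
  case False
  have in_J: "s \<in> J" if "0 \<le> s" for s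
  proof -
    obtain s' where "s' \<in> J" "s < s'"
      using False unfolding bdd_above_def by (meson not_le)
    then show ?thesis
      using J that unfolding is_interval_1 by (meson less_imp_le)
  qed
  show thesis
  proof (rule that[of "\<lambda>r. r / (1 - r)" "\<lambda>r. 1 / (1 - r)\<^sup>2"])
    show "(\<lambda>r. r / (1 - r)) ` {0..<1} \<subseteq> J"
      by (auto intro!: in_J)
    show "((\<lambda>r. r / (1 - r)) has_real_derivative 1 / (1 - r)\<^sup>2) (at r within {0..<1})" if "r \<in> {0..<1}" for r :: real
      using that by (auto intro!: derivative_eq_intros simp: power2_eq_square)
    show "continuous_on {0..<1::real} (\<lambda>r. 1 / (1 - r)\<^sup>2)"
      by (intro continuous_intros) auto
    show "\<exists>a\<in>{0..<1}. \<forall>r\<in>{a..<1}. b < r / (1 - r)" if b: "b \<in> J" for b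
    proof (intro bexI ballI)
      have "0 \<le> b"
        using b J(3) by auto
      \<comment> \<open>This witness is the parameter that \<open>r / (1 - r)\<close> sends to
        \<open>b + 1\<close>.\<close>
      then show "(b + 1) / (b + 2) \<in> {0..<1}"
        by auto
      fix r assume r: "r \<in> {(b + 1) / (b + 2)..<1}"
      then have "b + 1 \<le> r * (b + 2)"
        using \<open>0 \<le> b\<close> by (simp add: divide_le_eq)
      then have "b * (1 - r) < r"
        using r by (simp add: algebra_simps)
      then show "b < r / (1 - r)"
        using r by (simp add: less_divide_eq)
    qed
  qed auto
qed

lemma smooth_curve_reparametrized:
  assumes \<gamma>: "integral_curve M v \<gamma> J" and v: "continuous_on M v" "\<And>p. p \<in> M \<Longrightarrow> v p \<noteq> 0"
    and \<phi>: "\<phi> ` I \<subseteq> J" "\<And>r. r \<in> I \<Longrightarrow> (\<phi> has_real_derivative \<phi>' r) (at r within I)"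
      "continuous_on I \<phi>'" "\<And>r. r \<in> I \<Longrightarrow> \<phi>' r \<noteq> 0"
  shows "smooth_curve_on I (\<gamma> \<circ> \<phi>)" "continuous_on I (\<gamma> \<circ> \<phi>)"
proof -
  have deriv: "((\<gamma> \<circ> \<phi>) has_vector_derivative \<phi>' r *\<^sub>R v (\<gamma> (\<phi> r))) (at r within I)" if r: "r \<in> I" for r
  proof (rule vector_diff_chain_within)
    show "(\<phi> has_vector_derivative \<phi>' r) (at r within I)"
      using \<phi>(2)[OF r] by (simp add: has_real_derivative_iff_has_vector_derivative)
    show "(\<gamma> has_vector_derivative v (\<gamma> (\<phi> r))) (at (\<phi> r) within \<phi> ` I)"
      using integral_curve_derivative[OF \<gamma>, of "\<phi> r"] \<phi>(1) r
      by (auto intro: has_vector_derivative_within_subset)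
  qed
  then show cont: "continuous_on I (\<gamma> \<circ> \<phi>)"
    by (rule continuous_on_vector_derivative)
  have in_M: "\<gamma> (\<phi> r) \<in> M" if "r \<in> I" for r
    using integral_curve_mem[OF \<gamma>] \<phi>(1) that by auto
  have "continuous_on I (\<lambda>r. \<phi>' r *\<^sub>R v (\<gamma> (\<phi> r)))"
    using cont in_M by (intro continuous_on_scaleR \<phi>(3) continuous_on_compose2[OF v(1)]) (auto simp: o_def)
  then show "smooth_curve_on I (\<gamma> \<circ> \<phi>)"
    unfolding smooth_curve_on_def using deriv \<phi>(4) v(2) in_M
    by (intro exI[of _ "\<lambda>r. \<phi>' r *\<^sub>R v (\<gamma> (\<phi> r))"]) auto
qed

lemma smooth_curve_on_subset:
  assumes "smooth_curve_on S \<gamma>" "T \<subseteq> S"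
  shows "smooth_curve_on T \<gamma>"
proof -
  obtain \<gamma>' where "\<And>s. s \<in> S \<Longrightarrow> (\<gamma> has_vector_derivative \<gamma>' s) (at s within S)"
    "continuous_on S \<gamma>'" "\<And>s. s \<in> S \<Longrightarrow> \<gamma>' s \<noteq> 0"
    using assms(1) unfolding smooth_curve_on_def by blast
  then show ?thesis
    unfolding smooth_curve_on_def using assms(2)
    by (intro exI[of _ \<gamma>']) (auto intro: has_vector_derivative_within_subset continuous_on_subset)
qed

lemma smooth_curve_on_cong:
  assumes "smooth_curve_on S \<gamma>" "\<And>s. s \<in> S \<Longrightarrow> \<beta> s = \<gamma> s"
  shows "smooth_curve_on S \<beta>"
proof -
  obtain \<gamma>' where "\<And>s. s \<in> S \<Longrightarrow> (\<gamma> has_vector_derivative \<gamma>' s) (at s within S)"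
    "continuous_on S \<gamma>'" "\<And>s. s \<in> S \<Longrightarrow> \<gamma>' s \<noteq> 0"
    using assms(1) unfolding smooth_curve_on_def by blast
  moreover from this(1) have "(\<beta> has_vector_derivative \<gamma>' s) (at s within S)" if "s \<in> S" for s
    using that by (intro has_vector_derivative_transform[OF that assms(2)]) auto
  ultimately show ?thesis
    unfolding smooth_curve_on_def by blast
qed

section \<open>Limits and cluster points at the open end of a curve\<close>

lemma continuous_on_extend_by_limit:
  fixes g :: "real \<Rightarrow> 'a::metric_space"
  assumes cont: "continuous_on {0..<1} g"
    and lim: "\<And>e. 0 < e \<Longrightarrow> \<exists>a\<in>{0..<1}. \<forall>s\<in>{a..<1}. dist (g s) l < e"
  shows "continuous_on {0..1} (\<lambda>s. if s < 1 then g s else l)" (is "continuous_on _ ?k")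
  unfolding continuous_on_iff
proof (intro ballI allI impI)
  fix s e :: real assume s: "s \<in> {0..1}" and e: "0 < e"
  show "\<exists>d>0. \<forall>s'\<in>{0..1}. dist s' s < d \<longrightarrow> dist (?k s') (?k s) < e"
  proof (cases "s < 1")
    case True
    then obtain d where d: "0 < d" "\<And>s'. s' \<in> {0..<1} \<Longrightarrow> dist s' s < d \<Longrightarrow> dist (g s') (g s) < e"
      using cont s e unfolding continuous_on_iff by (metis atLeastLessThan_iff atLeastAtMost_iff)
    then show ?thesis
      using True s by (intro exI[of _ "min d (1 - s)"]) (auto simp: dist_real_def)
  next
    case False
    obtain a where a: "a \<in> {0..<1}" "\<And>s. s \<in> {a..<1} \<Longrightarrow> dist (g s) l < e"
      using lim[OF e] by blast
    show ?thesis
      using False s a e by (intro exI[of _ "1 - a"]) (auto simp: dist_real_def)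
  qed
qed

lemma compact_cluster_point:
  fixes g :: "real \<Rightarrow> 'a::metric_space"
  assumes K: "compact K" "g ` {0..<1} \<subseteq> K"
  obtains l where "l \<in> K" "\<And>s. s \<in> {0..<1} \<Longrightarrow> l \<in> closure (g ` {s..<1})"
proof -
  define t where "t = (\<lambda>n. 1 - inverse (real (Suc n)))"
  have t: "t n \<in> {0..<1}" for n
    by (simp add: t_def field_simps)
  have t_lim: "t \<longlonglongrightarrow> 1"
    unfolding t_def using LIMSEQ_inverse_real_of_nat tendsto_diff[of "\<lambda>_. 1::real" 1 sequentially] by fastforce
  have "\<forall>n. (g \<circ> t) n \<in> K"
    using K(2) t by (auto simp: image_subset_iff)
  with compact_imp_seq_compact[OF K(1)]
  obtain l r where l: "l \<in> K" and r: "strict_mono r" "((g \<circ> t) \<circ> r) \<longlonglongrightarrow> l"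
    by (rule seq_compactE)
  show thesis
  proof (rule that[OF l])
    fix s :: real assume s: "s \<in> {0..<1}"
    have "eventually (\<lambda>n. s < (t \<circ> r) n) sequentially"
      by (rule order_tendstoD(1)[OF LIMSEQ_subseq_LIMSEQ[OF t_lim r(1)]]) (use s in simp)
    then have "eventually (\<lambda>n. ((g \<circ> t) \<circ> r) n \<in> closure (g ` {s..<1})) sequentially"
    proof (rule eventually_mono)
      fix n assume "s < (t \<circ> r) n"
      then have "(t \<circ> r) n \<in> {s..<1}"
        using t[of "r n"] by simp
      then have "((g \<circ> t) \<circ> r) n \<in> g ` {s..<1}"
        by simp
      then show "((g \<circ> t) \<circ> r) n \<in> closure (g ` {s..<1})"
        by (rule subsetD[OF closure_subset])
    qed
    then show "l \<in> closure (g ` {s..<1})"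
      using r(2) by (rule Lim_in_closed_set[OF closed_closure _ sequentially_bot])
  qed
qed

text \<open>The curve would have to cross small spheres around \<open>l\<close> infinitely often, while \<open>u\<close> is
  bounded away from zero on these spheres.\<close>

lemma isolated_cluster_point_limit:
  fixes g :: "real \<Rightarrow> 'a::metric_space" and u :: "'a \<Rightarrow> real"
  assumes K: "compact K" "g ` {0..<1} \<subseteq> K" and g: "continuous_on {0..<1} g"
    and u: "continuous_on K u" "\<And>p. p \<in> K \<Longrightarrow> 0 \<le> u p"
    and lim: "\<And>e. 0 < e \<Longrightarrow> \<exists>a\<in>{0..<1}. \<forall>s\<in>{a..<1}. u (g s) < e"
    and cluster: "\<And>s. s \<in> {0..<1} \<Longrightarrow> l \<in> closure (g ` {s..<1})"
    and isolated: "0 < e0" "\<And>p. p \<in> K \<Longrightarrow> u p = 0 \<Longrightarrow> dist p l < e0 \<Longrightarrow> p = l"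
    and e: "0 < e"
  shows "\<exists>a\<in>{0..<1}. \<forall>s\<in>{a..<1}. dist (g s) l < e"
proof -
  \<comment> \<open>Being below \<open>e0\<close>, the radius admits no zero of \<open>u\<close> in
    \<open>K\<close> on the sphere: such a zero would be \<open>l\<close> itself, at distance
    \<open>0\<close>.\<close>
  define \<rho> where "\<rho> = min e e0 / 2"
  have \<rho>: "0 < \<rho>" "\<rho> < e" "\<rho> < e0"
    using e isolated(1) by (auto simp: \<rho>_def min_def)
  define S where "S = K \<inter> {p. dist p l = \<rho>}"
  have S: "compact S"
    unfolding S_def by (intro compact_Int_closed K(1) closed_Collect_eq continuous_intros)
  have pos: "0 < u p" if "p \<in> S" for p
    using that isolated(2)[of p] u(2)[of p] \<rho> by (force simp: S_def less_le)
  obtain m where m: "0 < m" "\<And>p. p \<in> S \<Longrightarrow> m \<le> u p"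
  proof (cases "S = {}")
    case False
    have "continuous_on S u"
      using u(1) by (rule continuous_on_subset) (auto simp: S_def)
    then obtain p where "p \<in> S" "\<forall>q\<in>S. u p \<le> u q"
      using continuous_attains_inf[OF S False] by blast
    then show ?thesis
      using that[of "u p"] pos by blast
  qed (use that[of 1] in auto)
  obtain a where a: "a \<in> {0..<1}" "\<And>s. s \<in> {a..<1} \<Longrightarrow> u (g s) < m"
    using lim[OF m(1)] by blast
  have not_on_sphere: "dist (g s) l \<noteq> \<rho>" if "s \<in> {a..<1}" for s
    using a(1) a(2)[OF that] m(2)[of "g s"] K(2) that by (force simp: S_def image_subset_iff)
  obtain s1 where s1: "s1 \<in> {a..<1}" "dist (g s1) l < \<rho>"
    using cluster[OF a(1)] \<rho>(1) unfolding closure_approachable by blast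
  have "continuous_on {a..<1} (\<lambda>s. dist (g s) l)"
    by (intro continuous_intros continuous_on_subset[OF g]) (use a(1) in auto)
  then have conn: "connected ((\<lambda>s. dist (g s) l) ` {a..<1})"
    by (rule connected_continuous_image) simp
  have "dist (g s) l < \<rho>" if s: "s \<in> {a..<1}" for s
  proof (rule ccontr)
    assume "\<not> dist (g s) l < \<rho>"
    then have "\<rho> \<in> (\<lambda>s. dist (g s) l) ` {a..<1}"
      by (intro connectedD_interval[OF conn imageI[OF s1(1)] imageI[OF s]]) (use s1 in auto)
    then show False
      using not_on_sphere by blast
  qed
  then show ?thesis
    using a(1) \<rho>(2) by (intro bexI[of _ a]) force+
qed

section \<open>The solution path\<close>

text \<open>For \<open>r \<ge> 0\<close> the ray from \<open>(x0, 1)\<close> in direction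
  \<open>(u, r)\<close> stays where \<open>H\<close> is explicit, and its one-sided derivative
  already determines \<open>D (u, r)\<close>.\<close>

lemma derivative_on_top_level:
  fixes H :: "(real^'n) \<times> real \<Rightarrow> real^'n"
  assumes deriv: "(H has_derivative D) (at (x0, 1))"
    and top: "\<And>x t. 1 \<le> t \<Longrightarrow> H (x, t) = t *\<^sub>R (x - x0)" and r: "0 \<le> r"
  shows "D (u, r) = u"
proof -
  have "((\<lambda>s. (x0 + s *\<^sub>R u, 1 + s *\<^sub>R r)) has_vector_derivative (u, r)) (at 0 within {0..})"
    unfolding has_vector_derivative_def
    by (auto intro!: derivative_eq_intros simp: fun_eq_iff)
  then have "((H \<circ> (\<lambda>s. (x0 + s *\<^sub>R u, 1 + s *\<^sub>R r))) has_vector_derivative D (u, r)) (at 0 within {0..})"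
    by (rule vector_derivative_diff_chain_within)
      (use deriv in \<open>auto intro: has_derivative_at_withinI\<close>)
  moreover have "((H \<circ> (\<lambda>s. (x0 + s *\<^sub>R u, 1 + s *\<^sub>R r))) has_vector_derivative u) (at 0 within {0..})"
  proof (rule has_vector_derivative_transform[where f = "\<lambda>s. (1 + s * r) *\<^sub>R s *\<^sub>R u"])
    show "((\<lambda>s. (1 + s * r) *\<^sub>R s *\<^sub>R u) has_vector_derivative u) (at 0 within {0..})"
      by (auto intro!: derivative_eq_intros simp: has_vector_derivative_def)
    show "(H \<circ> (\<lambda>s. (x0 + s *\<^sub>R u, 1 + s *\<^sub>R r))) s = (1 + s * r) *\<^sub>R s *\<^sub>R u" if "s \<in> {0..}" for s
      using that r by (simp add: top)
  qed simp
  moreover have "{0..} - {0::real} = {0<..}"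
    by auto
  then have "at (0::real) within {0..} \<noteq> bot"
    by (simp add: at_within_eq_bot_iff)
  ultimately show ?thesis
    by (rule vector_derivative_unique_within[rotated])
qed

text \<open>Bordering with \<open>(0, 1)\<close> gives the identity matrix, so the \<open>t\<close>
  component is \<open>1\<close>; the remaining components vanish because \<open>A\<close> maps the
  kernel vector to them.\<close>

lemma cross_rows_on_top_level:
  fixes A :: "(real^'n) \<times> real \<Rightarrow> real^'n"
  assumes "linear A" and A: "\<And>u r. 0 \<le> r \<Longrightarrow> A (u, r) = u"
  shows "cross_rows A = (0, 1)"
proof -
  have "bordered A (0, 1) = mat 1"
    by (auto simp: bordered_def mat_def vec_eq_iff coord_vec_def A axis_def split: option.splits)
  then have "snd (cross_rows A) = 1"
    using det_bordered[of A "(0, 1)"] by (simp add: inner_prod_def)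
  then have "cross_rows A = (fst (cross_rows A), 1)"
    by (metis prod.collapse)
  moreover from this have "fst (cross_rows A) = 0"
    using cross_rows_in_kernel[OF assms(1)] A[of 1 "fst (cross_rows A)"] by simp
  ultimately show ?thesis by simp
qed

theorem solution_path:
  fixes H :: "(real^'n) \<times> real \<Rightarrow> real^'n"
    and H' :: "(real^'n) \<times> real \<Rightarrow> ((real^'n) \<times> real) \<Rightarrow>\<^sub>L (real^'n)"
  assumes deriv: "\<And>p. (H has_derivative blinfun_apply (H' p)) (at p)" and cont: "continuous_on UNIV H'"
    and confined: "compact X" "\<And>x t. \<lbrakk>H (x, t) = 0; 0 \<le> t; t \<le> 1\<rbrakk> \<Longrightarrow> x \<in> X"
    and top: "\<And>x t. 1 \<le> t \<Longrightarrow> H (x, t) = t *\<^sub>R (x - x0)"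
    and regular: "\<And>p. \<lbrakk>H p = 0; 0 < snd p; snd p < 1\<rbrakk> \<Longrightarrow> surj (blinfun_apply (H' p))"
  obtains \<gamma> x where
    "path_image \<gamma> \<subseteq> {p. H p = 0 \<and> snd p \<in> {0..1}}"
    "pathstart \<gamma> = (x0, 1)" "pathfinish \<gamma> = (x, 0)"
    "smooth_curve_on {0..<1} \<gamma>" "continuous_on {0..1} (\<lambda>s. snd (\<gamma> s))"
    "\<And>s. s \<in> {0..<1} \<Longrightarrow> (x, 0) \<in> closure (\<gamma> ` {s..<1})"
    "x isolated_in {y. H (y, 0) = 0} \<Longrightarrow> path \<gamma>"
    "\<forall>p. H p = 0 \<and> snd p = 0 \<longrightarrow> surj (blinfun_apply (H' p)) \<Longrightarrow> smooth_curve_on {0..1} \<gamma>"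
proof -
  \<comment> \<open>The sign makes the field point towards smaller \<open>t\<close> at
    \<open>p0\<close>.\<close>
  define v where "v = (\<lambda>p. - cross_rows (blinfun_apply (H' p)))"
  define M where "M = {p. H p = 0 \<and> v p \<noteq> 0}"
  define p0 where "p0 = (x0, 1::real)"
  have lin: "linear (blinfun_apply (H' p))" for p
    by (simp add: blinfun.bounded_linear_right bounded_linear.linear)
  have v_surj: "v p \<noteq> 0 \<longleftrightarrow> surj (blinfun_apply (H' p))" for p
    using cross_rows_nonzero_iff[OF lin] by (simp add: v_def)
  have cont_v: "continuous_on UNIV v"
    unfolding v_def by (intro continuous_on_minus continuous_on_cross_rows cont)
  have kernel: "H' p (v p) = 0" for p
    using cross_rows_in_kernel[OF lin] by (simp add: v_def linear_neg[OF lin])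
  interpret flow_box_space M v
  proof
    fix p assume "p \<in> M"
    then have p: "p \<in> {p. H p = 0 \<and> v p \<noteq> 0}"
      by (simp add: M_def)
    show "\<exists>U \<sigma> c \<delta>. p \<in> U \<and> flow_box M v U \<sigma> c \<delta>"
    proof (rule flow_box_exists[OF deriv cont cont_v kernel _ p])
      show "surj (blinfun_apply (H' q))" if "v q \<noteq> 0" for q
        using that v_surj by blast
      fix U \<sigma> c \<delta> assume "p \<in> U" "flow_box {p. H p = 0 \<and> v p \<noteq> 0} v U \<sigma> c \<delta>"
      then show "\<exists>U \<sigma> c \<delta>. p \<in> U \<and> flow_box M v U \<sigma> c \<delta>"
        unfolding M_def by blast
    qed
  qed
  have v_p0: "v p0 = (0, -1)"
    using cross_rows_on_top_level[OF lin derivative_on_top_level[OF deriv[of p0, unfolded p0_def] top]]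
    by (simp add: v_def p0_def)
  have zero_top: "p = p0" if "H p = 0" "snd p = 1" for p
    using that top[of 1 "fst p"] by (cases p) (simp add: p0_def)
  have "p0 \<in> M"
    using v_p0 top[of 1 x0] by (simp add: M_def p0_def zero_prod_def)
  then obtain J \<gamma> where J: "0 \<in> J" "J \<subseteq> {0..}" "is_interval J"
    and \<gamma>: "integral_curve M v \<gamma> J" "\<gamma> 0 = p0"
    and no_max: "\<And>s. s \<in> J \<Longrightarrow> \<exists>s'\<in>J. s < s'"
    and escape: "\<And>K. \<lbrakk>compact K; K \<subseteq> M; \<forall>s\<in>J. 0 < s \<longrightarrow> \<gamma> s \<noteq> p0\<rbrakk>
       \<Longrightarrow> \<exists>b\<in>J. \<forall>s\<in>J. b < s \<longrightarrow> \<gamma> s \<notin> K"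
    by (rule maximal_integral_curve) (rule that)
  define y where "y = (\<lambda>s. snd (\<gamma> s))"
  have H_\<gamma>: "H (\<gamma> s) = 0" if "s \<in> J" for s
    using integral_curve_mem[OF \<gamma>(1) that] by (simp add: M_def)
  have y': "(y has_real_derivative snd (v (\<gamma> s))) (at s within J)" if "s \<in> J" for s
    using bounded_linear.has_vector_derivative[OF bounded_linear_snd integral_curve_derivative[OF \<gamma>(1) that]]
    by (simp add: y_def has_real_derivative_iff_has_vector_derivative)
  have y0: "y 0 = 1"
    by (simp add: y_def \<gamma>(2) p0_def)
  have y_less: "y s < 1" if "s \<in> J" "0 < s" for s
  proof (rule stays_below_start[OF J(3,1) y' y0 _ that])
    fix r assume "r \<in> J" "y r = 1"
    then have "\<gamma> r = p0"
      using zero_top H_\<gamma> by (simp add: y_def)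
    then show "snd (v (\<gamma> r)) < 0"
      by (simp add: v_p0)
  qed
  have y_le: "y s \<le> 1" if "s \<in> J" for s
    using y_less[OF that] y0 J(2) that by (cases "s = 0") force+
  have no_return: "\<forall>s\<in>J. 0 < s \<longrightarrow> \<gamma> s \<noteq> p0"
  proof (intro ballI impI notI)
    fix s assume "s \<in> J" "0 < s" "\<gamma> s = p0"
    then show False
      using y_less[of s] by (simp add: y_def p0_def)
  qed
  \<comment> \<open>For \<open>a > 0\<close> this compact set consists of regular zeros,
    \<open>p0\<close> being its only point on level \<open>1\<close>. The slice \<open>K 0\<close>
    may contain singular zeros.\<close>
  define K where "K = (\<lambda>a::real. {p. H p = 0} \<inter> X \<times> {a..1})"
  have "continuous_on UNIV H"
    using has_derivative_continuous[OF deriv] by (intro continuous_at_imp_continuous_on) auto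
  then have "closed {p. H p = 0}"
    by (intro closed_Collect_eq continuous_on_const)
  then have K: "compact (K a)" for a
    unfolding K_def by (intro closed_Int_compact compact_Times confined(1)) auto
  have in_K: "\<gamma> s \<in> K a" if "s \<in> J" "a \<le> y s" "0 \<le> y s" for s a
    using that H_\<gamma>[OF that(1)] y_le[OF that(1)] confined(2)[of "fst (\<gamma> s)" "y s"]
    by (simp add: K_def y_def mem_Times_iff)
  have K_M: "K a \<subseteq> M" if "0 < a" for a
  proof
    fix p assume p: "p \<in> K a"
    show "p \<in> M"
    proof (cases "snd p = 1")
      case True
      then show ?thesis
        using zero_top[of p] p \<open>p0 \<in> M\<close> by (simp add: K_def)
    next
      case False
      then have "surj (blinfun_apply (H' p))"
        using p that by (intro regular) (auto simp: K_def)
      then show ?thesis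
        using p v_surj by (simp add: M_def K_def)
    qed
  qed
  have v_M: "continuous_on M v" "\<And>p. p \<in> M \<Longrightarrow> v p \<noteq> 0"
    by (auto intro: continuous_on_subset[OF cont_v] simp: M_def)
  show thesis
  \<comment> \<open>As \<open>H\<close> is defined for negative \<open>t\<close> too, the maximal
    curve may cross level \<open>0\<close>; it is then cut at the first hit. Otherwise its whole
    open-ended lifetime is compressed to \<open>{0..<1}\<close>.\<close>
  proof (cases "\<exists>s\<in>J. y s \<le> 0")
    case True
    then obtain s1 where s1: "s1 \<in> J" "y s1 \<le> 0"
      by blast
    have in_J: "s \<in> J" if "0 \<le> s" "s \<le> s1" for s
      using that J s1 unfolding is_interval_1 by blast
    have "0 \<le> s1"
      using s1 J(2) by auto
    have "continuous_on J y"
      using y' by (rule DERIV_continuous_on)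
    then have "continuous_on {0..s1} y"
      by (rule continuous_on_subset) (use in_J in auto)
    then obtain s where s: "0 < s" "s \<le> s1" "y s = 0" "\<And>r. 0 \<le> r \<Longrightarrow> r < s \<Longrightarrow> 0 < y r"
      by (rule first_hit[where c = 0]) (use \<open>0 \<le> s1\<close> s1(2) y0 in auto)
    define \<beta> where "\<beta> = \<gamma> \<circ> (\<lambda>r. s * r)"
    have in_s: "0 \<le> s * r" "s * r \<le> s" "s * r \<in> J" if "r \<in> {0..1}" for r
    proof -
      show "0 \<le> s * r" "s * r \<le> s"
        using that s(1) mult_left_le[of r s] by auto
      then show "s * r \<in> J"
        using s(2) by (intro in_J) auto
    qed
    have sub: "(\<lambda>r. s * r) ` {0..1} \<subseteq> J"
      using in_s(3) by blast
    have der: "((\<lambda>r. s * r) has_real_derivative s) (at r within {0..1})" for r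
      by (auto intro!: derivative_eq_intros)
    note param = smooth_curve_reparametrized[OF \<gamma>(1) v_M sub der continuous_on_const, folded \<beta>_def]
    have smooth: "smooth_curve_on {0..1} \<beta>"
      by (rule param(1)) (use s(1) in auto)
    have cont_\<beta>: "continuous_on {0..1} \<beta>"
      by (rule param(2)) (use s(1) in auto)
    define x where "x = fst (\<gamma> s)"
    have \<beta>1: "\<beta> 1 = (x, 0)"
      using s(3) by (simp add: \<beta>_def x_def y_def prod_eq_iff)
    show thesis
    proof (rule that[of \<beta> x])
      have "H (\<beta> r) = 0 \<and> snd (\<beta> r) \<in> {0..1}" if r: "r \<in> {0..1}" for r
      proof -
        have "0 \<le> y u" if "0 \<le> u" "u \<le> s" for u
          using s(3) s(4)[of u] that by (cases "u = s") auto
        then have "0 \<le> y (s * r)"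
          using in_s[OF r] by blast
        then show ?thesis
          using H_\<gamma>[OF in_s(3)[OF r]] y_le[OF in_s(3)[OF r]] by (simp add: \<beta>_def y_def)
      qed
      then show "path_image \<beta> \<subseteq> {p. H p = 0 \<and> snd p \<in> {0..1}}"
        by (auto simp: path_image_def)
      show "pathstart \<beta> = (x0, 1)" "pathfinish \<beta> = (x, 0)"
        using \<beta>1 \<gamma>(2) by (simp_all add: pathstart_def pathfinish_def \<beta>_def p0_def)
      show "smooth_curve_on {0..<1} \<beta>"
        by (rule smooth_curve_on_subset[OF smooth]) auto
      show "continuous_on {0..1} (\<lambda>s. snd (\<beta> s))"
        by (intro continuous_on_snd cont_\<beta>)
      show "path \<beta>"
        using cont_\<beta> by (simp add: path_def)
      show "(x, 0) \<in> closure (\<beta> ` {r..<1})" if r: "r \<in> {0..<1}" for r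
      proof -
        have closure: "closure {r..<1} = {r..1}"
          using r by simp
        have "\<beta> ` closure {r..<1} \<subseteq> closure (\<beta> ` {r..<1})"
        proof (rule image_closure_subset)
          show "continuous_on (closure {r..<1}) \<beta>"
            unfolding closure by (rule continuous_on_subset[OF cont_\<beta>]) (use r in auto)
        qed (auto intro: subsetD[OF closure_subset])
        then have "\<beta> 1 \<in> closure (\<beta> ` {r..<1})"
          unfolding closure using r by (auto simp: image_subset_iff)
        then show ?thesis
          by (simp add: \<beta>1)
      qed
    qed (rule smooth)
  next
    case False
    then have y_pos: "0 < y s" if "s \<in> J" for s
      using that by (meson not_le)
    obtain \<phi> \<phi>' where \<phi>: "\<phi> 0 = 0" "\<phi> ` {0..<1} \<subseteq> J"
      "\<And>r. r \<in> {0..<1} \<Longrightarrow> (\<phi> has_real_derivative \<phi>' r) (at r within {0..<1})"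
      "continuous_on {0..<1} \<phi>'" "\<And>r. r \<in> {0..<1} \<Longrightarrow> \<phi>' r \<noteq> 0"
      and \<phi>_large: "\<And>b. b \<in> J \<Longrightarrow> \<exists>a\<in>{0..<1}. \<forall>r\<in>{a..<1}. b < \<phi> r"
      by (rule interval_parametrization[OF J(3,1,2) no_max]) (assumption, rule that)
    define g where "g = \<gamma> \<circ> \<phi>"
    note smooth_g = smooth_curve_reparametrized[OF \<gamma>(1) v_M \<phi>(2-5), folded g_def]
    have \<phi>_J: "\<phi> r \<in> J" if "r \<in> {0..<1}" for r
      using \<phi>(2) that by blast
    have g_K: "g ` {0..<1} \<subseteq> K 0"
    proof (rule image_subsetI)
      fix r :: real assume r: "r \<in> {0..<1}"
      show "g r \<in> K 0"
        using in_K[OF \<phi>_J[OF r], of 0] y_pos[OF \<phi>_J[OF r]] by (simp add: g_def)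
    qed
    \<comment> \<open>While its level is at least \<open>e\<close>, the curve lies in
      \<open>K e\<close>, which it leaves for good; hence the level tends to
      \<open>0\<close>.\<close>
    have low: "\<exists>a\<in>{0..<1}. \<forall>s\<in>{a..<1}. snd (g s) < e" if e: "0 < e" for e
    proof -
      obtain b where b: "b \<in> J" "\<forall>s\<in>J. b < s \<longrightarrow> \<gamma> s \<notin> K e"
        using escape[OF K K_M[OF e] no_return] by blast
      obtain a where a: "a \<in> {0..<1}" "\<forall>r\<in>{a..<1}. b < \<phi> r"
        using \<phi>_large[OF b(1)] by blast
      have "snd (g r) < e" if r: "r \<in> {a..<1}" for r
      proof -
        have "\<phi> r \<in> J" "b < \<phi> r"
          using a r by (auto intro!: \<phi>_J)
        then have "\<not> e \<le> y (\<phi> r)"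
          using b(2) in_K[of "\<phi> r" e] y_pos[of "\<phi> r"] by auto
        then show ?thesis
          by (simp add: g_def y_def)
      qed
      with a(1) show ?thesis by blast
    qed
    \<comment> \<open>A limit need not exist, so a cluster point serves as the end; it lies on level
      \<open>0\<close> because the levels of the tails tend to \<open>0\<close>.\<close>
    obtain l where l: "l \<in> K 0" "\<And>s. s \<in> {0..<1} \<Longrightarrow> l \<in> closure (g ` {s..<1})"
      using compact_cluster_point[OF K g_K] by blast
    have "snd l \<le> e" if e: "0 < e" for e
    proof -
      obtain a where a: "a \<in> {0..<1}" "\<forall>s\<in>{a..<1}. snd (g s) < e"
        using low[OF e] by blast
      have "closure (g ` {a..<1}) \<subseteq> {p. snd p \<le> e}"
        using a(2) by (intro closure_minimal closed_Collect_le continuous_intros) force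
      then show ?thesis
        using l(2)[OF a(1)] by auto
    qed
    then have "snd l = 0"
      using l(1) field_le_epsilon[of "snd l" 0] by (auto simp: K_def)
    define x where "x = fst l"
    have l_eq: "l = (x, 0)"
      using \<open>snd l = 0\<close> by (simp add: x_def prod_eq_iff)
    define \<beta> where "\<beta> = (\<lambda>s. if s < 1 then g s else l)"
    have \<beta>_g: "\<beta> s = g s" if "s \<in> {0..<1}" for s
      using that by (simp add: \<beta>_def)
    have \<beta>_K: "\<beta> s \<in> K 0" if "s \<in> {0..1}" for s
      using that g_K l(1) by (auto simp: \<beta>_def)
    show thesis
    proof (rule that[of \<beta> x])
      show "path_image \<beta> \<subseteq> {p. H p = 0 \<and> snd p \<in> {0..1}}"
        using \<beta>_K by (force simp: path_image_def K_def)
      show "pathstart \<beta> = (x0, 1)" "pathfinish \<beta> = (x, 0)"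
        using \<gamma>(2) \<phi>(1) l_eq by (simp_all add: pathstart_def pathfinish_def \<beta>_def p0_def g_def)
      show "smooth_curve_on {0..<1} \<beta>"
        by (rule smooth_curve_on_cong[OF smooth_g(1) \<beta>_g])
      have "continuous_on {0..1} (\<lambda>s. if s < 1 then snd (g s) else 0)"
      proof (rule continuous_on_extend_by_limit)
        show "continuous_on {0..<1} (\<lambda>s. snd (g s))"
          by (intro continuous_on_snd smooth_g(2))
        fix e :: real assume "0 < e"
        then obtain a where a: "a \<in> {0..<1}" "\<forall>s\<in>{a..<1}. snd (g s) < e"
          using low by blast
        have "dist (snd (g s)) 0 < e" if s: "s \<in> {a..<1}" for s
        proof -
          have "g s \<in> K 0"
            using g_K a(1) s by (auto simp: image_subset_iff)
          then show ?thesis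
            using a(2) s by (simp add: K_def mem_Times_iff)
        qed
        with a(1) show "\<exists>a\<in>{0..<1}. \<forall>s\<in>{a..<1}. dist (snd (g s)) 0 < e"
          by blast
      qed
      then show "continuous_on {0..1} (\<lambda>s. snd (\<beta> s))"
        by (rule continuous_on_eq) (simp add: \<beta>_def l_eq)
      show "(x, 0) \<in> closure (\<beta> ` {s..<1})" if "s \<in> {0..<1}" for s
      proof -
        have "\<beta> ` {s..<1} = g ` {s..<1}"
          using that by (intro image_cong) (auto simp: \<beta>_def)
        then show ?thesis
          using l(2)[OF that] l_eq by simp
      qed
      show "path \<beta>" if isolated: "x isolated_in {y. H (y, 0) = 0}"
      proof -
        obtain e0 where e0: "0 < e0" "\<And>z. H (z, 0) = 0 \<Longrightarrow> dist x z < e0 \<Longrightarrow> z = x"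
          using isolated by (auto simp: isolated_in_dist_Ex_iff)
        have "\<exists>a\<in>{0..<1}. \<forall>s\<in>{a..<1}. dist (g s) l < e" if "0 < e" for e
        proof (rule isolated_cluster_point_limit[OF K g_K smooth_g(2) _ _ low l(2) e0(1) _ that])
          show "continuous_on (K 0) snd"
            by (intro continuous_intros)
          show "0 \<le> snd p" if "p \<in> K 0" for p
            using that by (auto simp: K_def)
          show "p = l" if "p \<in> K 0" "snd p = 0" "dist p l < e0" for p
            using that e0(2)[of "fst p"]
            by (cases p) (auto simp: K_def l_eq dist_Pair_Pair dist_commute)
        qed
        then have "continuous_on {0..1} \<beta>"
          unfolding \<beta>_def by (intro continuous_on_extend_by_limit smooth_g(2))
        then show ?thesis
          by (simp add: path_def)
      qed
      show "smooth_curve_on {0..1} \<beta>"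
        if reg0: "\<forall>p. H p = 0 \<and> snd p = 0 \<longrightarrow> surj (blinfun_apply (H' p))"
      proof -
        \<comment> \<open>With regularity on level \<open>0\<close> this case is contradictory: the
          curve would have to leave the compact set \<open>K 0\<close> of regular zeros, yet it
          always stays in it. So only the case of a finite hit remains, where smoothness up to the
          end is known.\<close>
        have "K 0 \<subseteq> M"
        proof
          fix p assume p: "p \<in> K 0"
          show "p \<in> M"
          proof (cases "snd p = 0")
            case True
            then show ?thesis
              using p spec[OF reg0, of p] v_surj by (simp add: M_def K_def)
          next
            case False
            then have "0 < snd p" "p \<in> K (snd p)"
              using p by (auto simp: K_def mem_Times_iff)
            then show ?thesis
              using K_M by blast
          qed
        qed
        then obtain b where b: "b \<in> J" "\<forall>s\<in>J. b < s \<longrightarrow> \<gamma> s \<notin> K 0"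
          using escape[OF K _ no_return] by blast
        obtain s where "s \<in> J" "b < s"
          using no_max[OF b(1)] by blast
        then have False
          using b(2) in_K[of s 0] y_pos[of s] by auto
        then show ?thesis ..
      qed
    qed
  qed
qed

section \<open>The sample-average homotopy\<close>

text \<open>\<open>jacobian_xt\<close> differentiates within the strip, \<open>D\<close> in the
  whole space. They agree because the strip contains arbitrarily short steps in every coordinate
  direction, even at its boundary, so the derivative within it is unique.\<close>

lemma full_rank_jacobian_iff:
  fixes h H :: "(real^'n) \<times> real \<Rightarrow> real^'n"
  assumes H: "(H has_derivative D) (at p)" and eq: "\<And>q. snd q \<in> {0..1} \<Longrightarrow> h q = H q"
    and p: "snd p \<in> {0..1}"
  shows "rank (jacobian_xt h p) = CARD('n) \<longleftrightarrow> surj D"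
proof -
  let ?S = "(UNIV :: (real^'n) set) \<times> {0..1::real}"
  have D: "(h has_derivative D) (at p within ?S)"
    using p by (intro has_derivative_transform[OF _ _ has_derivative_at_withinI[OF H]])
      (auto simp: eq mem_Times_iff)
  then have "(h has_derivative frechet_derivative h (at p within ?S)) (at p within ?S)"
    unfolding frechet_derivative_works[symmetric] differentiable_def by blast
  then have "frechet_derivative h (at p within ?S) = D"
  proof (rule frechet_derivative_unique_within[OF _ D])
    fix i :: "(real^'n) \<times> real" and e :: real assume i: "i \<in> Basis" and e: "0 < e"
    \<comment> \<open>The step goes upwards except on level \<open>1\<close>, where it has to go
      downwards to stay in the strip.\<close>
    define d where "d = (if snd p < 1 then min (e / 2) (1 - snd p) else - min (e / 2) 1)"
    have d: "0 < \<bar>d\<bar>" "\<bar>d\<bar> < e" "snd p + d \<in> {0..1}"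
      using e p by (auto simp: d_def min_def split: if_splits)
    have "snd i = 0 \<or> snd i = 1"
      using i by (auto simp: Basis_prod_def)
    then have "p + d *\<^sub>R i \<in> ?S"
      using d p by (auto simp: mem_Times_iff)
    with d show "\<exists>d. 0 < \<bar>d\<bar> \<and> \<bar>d\<bar> < e \<and> p + d *\<^sub>R i \<in> ?S"
      by (intro exI[of _ d]) simp
  qed
  then show ?thesis
    using full_rank_iff_surj_derivative[of D] has_derivative_linear[OF H]
    by (simp add: jacobian_xt_def coord_vec_def)
qed

lemma sample_avg_outward:
  assumes pos: "\<And>i. i \<in> {1..m} \<Longrightarrow> 0 < w \<bullet> f x (\<xi> i)" and m: "0 < m"
  shows "0 < w \<bullet> sample_avg f \<xi> m x"
proof -
  have "0 < (\<Sum>i=1..m. w \<bullet> f x (\<xi> i))"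
    using m by (intro sum_pos pos) auto
  then show ?thesis
    using m by (simp add: sample_avg_def inner_sum_right)
qed

lemma strict_chain_le:
  fixes q :: "nat \<Rightarrow> nat"
  assumes step: "\<And>l. l \<in> {1..<L} \<Longrightarrow> q l < q (Suc l)" and l: "1 \<le> l" "l \<le> L"
  shows "q 1 \<le> q l" "q l \<le> q L"
proof -
  show "q l \<le> q L"
    using l(2)
  proof (induction rule: inc_induct)
    case (step n)
    then show ?case
      using assms(1)[of n] l(1) by force
  qed simp
  show "q 1 \<le> q l"
    using l
  proof (induction l rule: dec_induct)
    case (step n)
    then show ?case
      using assms(1)[of n] by force
  qed simp
qed

lemma theta_bounds: "0 \<le> theta \<tau> l t" "theta \<tau> l t \<le> 1"
  by (simp_all add: theta_def abs_square_le_1)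

theorem theorem3:
  fixes f :: "real^'n \<Rightarrow> 'w \<Rightarrow> real^'n"
    and \<Omega> :: "'w set" and \<xi> :: "nat \<Rightarrow> 'w"
    and N L :: nat and q :: "nat \<Rightarrow> nat" and \<tau> :: "nat \<Rightarrow> real"
    and X :: "(real^'n) set" and x0 :: "real^'n"
    and h :: "(real^'n) \<times> real \<Rightarrow> real^'n"
  assumes f_C1: "\<And>\<omega>. \<omega> \<in> \<Omega> \<Longrightarrow> continuously_differentiable (\<lambda>x. f x \<omega>)"
    and N: "1 \<le> N" and samples: "\<And>i. i \<in> {1..N} \<Longrightarrow> \<xi> i \<in> \<Omega>"
    and L: "1 \<le> L" "L \<le> N"
    and q: "0 < q 1" "\<And>l. l \<in> {1..<L} \<Longrightarrow> q l < q (Suc l)" "q L = N"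
    and \<tau>: "\<tau> 0 = 1" "\<And>l. l < L \<Longrightarrow> \<tau> (Suc l) < \<tau> l" "\<tau> L = 0"
    and X: "compact X" "convex X" "interior X \<noteq> {}"
    and outward: "\<And>\<omega> x y. \<lbrakk>\<omega> \<in> \<Omega>; x \<notin> interior X; y \<in> interior X\<rbrakk> \<Longrightarrow> (x - y) \<bullet> f x \<omega> > 0"
    and x0: "x0 \<in> interior X"
    and h: "h = homotopy_map f \<xi> q \<tau> L x0"
    and regular: "zero_regular_value_on h (UNIV \<times> {0<..<1})"
  shows "{x. h (x, 1) = 0} = {x0} \<and>
         (\<exists>\<gamma> x.
           path_image \<gamma> \<subseteq> H_inv h \<and>
           pathstart \<gamma> = (x0, 1) \<and>
           pathfinish \<gamma> = (x, 0) \<and> sample_avg f \<xi> N x = 0 \<and>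
           smooth_curve_on {0..<1} \<gamma> \<and>
           continuous_on {0..1} (\<lambda>s. snd (\<gamma> s)) \<and>
           (\<forall>s\<in>{0..<1}. (x, 0) \<in> closure (\<gamma> ` {s..<1})) \<and>
           (x isolated_in {y. sample_avg f \<xi> N y = 0} \<longrightarrow> path \<gamma>) \<and>
           (zero_regular_value_on h (UNIV \<times> {0..<1}) \<longrightarrow> smooth_curve_on {0..1} \<gamma>))"
proof -
  define H where "H = extended_homotopy f \<xi> q \<tau> L x0"
  have h_H: "h p = H p" if "snd p \<in> {0..1}" for p
    unfolding h H_def using that by (intro homotopy_map_eq_extended \<tau>(2) L(1)) (auto simp: \<tau>(1,3))
  have top: "H (x, t) = t *\<^sub>R (x - x0)" if "1 \<le> t" for x t
    unfolding H_def by (rule extended_homotopy_above[where \<tau> = \<tau> and L = L, OF \<tau>(2)]) (simp_all add: \<tau>(1) that)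
  have bottom: "H (x, 0) = sample_avg f \<xi> N x" for x
  proof -
    have "\<tau> L < \<tau> (L - 1)"
      using \<tau>(2)[of "L - 1"] L(1) by simp
    then have "H (x, 0) = d_piece f \<xi> q \<tau> L x 0" "theta \<tau> L 0 = 1"
      unfolding H_def using L(1) by (simp_all add: \<tau>(3) theta_def extended_homotopy_eq[where \<tau> = \<tau> and L = L and l = L, OF \<tau>(2)])
    then show ?thesis
      using L(1) by (simp add: d_piece_def level_map_def q(3))
  qed
  have q_bounds: "0 < q l" "q l \<le> N" if "l \<in> {1..L}" for l
    using strict_chain_le[where q = q and L = L and l = l, OF q(2)] that q(1,3) by auto
  have level_pos: "0 < (x - x0) \<bullet> level_map f \<xi> q l x" if x: "x \<notin> interior X" and l: "l \<in> {1..L}" for x l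
  proof -
    have "0 < (x - x0) \<bullet> f x (\<xi> i)" if "i \<in> {1..q l}" for i
      using q_bounds[OF l] that by (intro outward samples x x0) auto
    then have "0 < (x - x0) \<bullet> sample_avg f \<xi> (q l) x"
      by (rule sample_avg_outward) (use q_bounds(1)[OF l] in auto)
    then show ?thesis
      using l by (simp add: level_map_def)
  qed
  have level_nonneg: "0 \<le> (x - x0) \<bullet> level_map f \<xi> q l x" if "x \<notin> interior X" "l \<le> L" for x l
    using level_pos[OF that(1), of l] that(2) by (cases "l = 0") (auto simp: level_map_def)
  \<comment> \<open>Outside the interior all levels have a nonnegative inner product with
    \<open>x - x0\<close>, while the term \<open>t *\<^sub>R (x - x0)\<close> contributes strictly
    for \<open>t > 0\<close>. This leaves \<open>t = 0\<close>, where the full sample average is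
    strictly outward.\<close>
  have confined: "x \<in> X" if zero: "H (x, t) = 0" and t: "0 \<le> t" "t \<le> 1" for x t
  proof -
    have "x \<in> interior X"
    proof (rule ccontr)
      assume x: "x \<notin> interior X"
      obtain l where l: "l \<in> {1..L}" "t \<in> {\<tau> l..\<tau> (l - 1)}"
        using exists_level[where \<tau> = \<tau> and L = L, OF \<tau>(2) L(1), of t] t \<tau>(1,3) by auto
      have "0 \<le> (x - x0) \<bullet> d_piece f \<xi> q \<tau> l x t"
        using level_nonneg[OF x, of l] level_nonneg[OF x, of "l - 1"] l(1) theta_bounds[of \<tau> l t]
        by (auto simp: d_piece_def inner_add_right)
      moreover have "(1 - t) * ((x - x0) \<bullet> d_piece f \<xi> q \<tau> l x t) + t * ((x - x0) \<bullet> (x - x0)) = 0"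
      proof -
        have "H (x, t) = (1 - t) *\<^sub>R d_piece f \<xi> q \<tau> l x t + t *\<^sub>R (x - x0)"
          unfolding H_def by (rule extended_homotopy_eq[OF \<tau>(2) l])
        then have "(x - x0) \<bullet> ((1 - t) *\<^sub>R d_piece f \<xi> q \<tau> l x t + t *\<^sub>R (x - x0)) = 0"
          using zero by simp
        then show ?thesis
          by (simp only: inner_add_right inner_scaleR_right)
      qed
      moreover have "0 < (x - x0) \<bullet> (x - x0)"
        using x x0 by auto
      ultimately have "t = 0"
        using t by (smt (verit) mult_nonneg_nonneg mult_pos_pos)
      then show False
        using zero bottom[of x] level_pos[OF x, of L] L(1) by (simp add: level_map_def q(3))
    qed
    then show ?thesis
      using interior_subset by blast
  qed
  have "continuously_differentiable H"
    unfolding H_def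
  proof (rule continuously_differentiable_extended_homotopy)
    fix l i assume "l \<in> {1..L}" "i \<in> {1..q l}"
    then show "continuously_differentiable (\<lambda>x. f x (\<xi> i))"
      using q_bounds[of l] by (intro f_C1 samples) auto
  qed
  then obtain H' where H': "\<And>p. (H has_derivative blinfun_apply (H' p)) (at p)" "continuous_on UNIV H'"
    by (rule continuously_differentiableE) (rule that)
  \<comment> \<open>The set \<open>S\<close> is left open, as the fact serves both the open strip
    and the strip including level \<open>0\<close>.\<close>
  have surj: "surj (blinfun_apply (H' p))"
    if "zero_regular_value_on h S" "p \<in> S" "H p = 0" "snd p \<in> {0..1}" for S p
    using that h_H[of p] full_rank_jacobian_iff[OF H'(1) h_H, of p]
    by (auto simp: zero_regular_value_on_def)
  have interior_surj: "surj (blinfun_apply (H' p))" if "H p = 0" "0 < snd p" "snd p < 1" for p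
    using that by (intro surj[OF regular]) (auto simp: mem_Times_iff)
  obtain \<gamma> x where path:
    "path_image \<gamma> \<subseteq> {p. H p = 0 \<and> snd p \<in> {0..1}}"
    "pathstart \<gamma> = (x0, 1)" "pathfinish \<gamma> = (x, 0)"
    "smooth_curve_on {0..<1} \<gamma>" "continuous_on {0..1} (\<lambda>s. snd (\<gamma> s))"
    and cluster: "\<And>s. s \<in> {0..<1} \<Longrightarrow> (x, 0) \<in> closure (\<gamma> ` {s..<1})"
    and isolated: "x isolated_in {y. H (y, 0) = 0} \<Longrightarrow> path \<gamma>"
    and smooth: "\<forall>p. H p = 0 \<and> snd p = 0 \<longrightarrow> surj (blinfun_apply (H' p)) \<Longrightarrow> smooth_curve_on {0..1} \<gamma>"
    by (rule solution_path[OF H' X(1) confined top interior_surj]) (assumption+, rule that)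
  have "{x. h (x, 1) = 0} = {x0}"
    using h_H[of "(_, 1)"] top[of 1] by auto
  moreover have "path_image \<gamma> \<subseteq> H_inv h"
    using path(1) h_H by (auto simp: H_inv_def)
  moreover have "sample_avg f \<xi> N x = 0"
  proof -
    have "(x, 0) \<in> path_image \<gamma>"
      unfolding path(3)[symmetric] by (rule pathfinish_in_path_image)
    then show ?thesis
      using path(1) bottom[of x] by auto
  qed
  moreover have "x isolated_in {y. sample_avg f \<xi> N y = 0} \<longrightarrow> path \<gamma>"
    using isolated by (simp add: bottom)
  moreover have "zero_regular_value_on h (UNIV \<times> {0..<1}) \<longrightarrow> smooth_curve_on {0..1} \<gamma>"
    using smooth surj[of "UNIV \<times> {0..<1}"] by (auto simp: mem_Times_iff)
  ultimately show ?thesis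
    using path(2-5) cluster by blast
qed

end
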